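(* Let $a\ge0$ be a fixed real number that is not a positive integer, and for each positive integer $M$ let $q=\exp\left(\frac{2\pi i}{M+a}\right)$. Then, as $M\to\infty$, $$J_M(4_1;q)\ \sim\ -\frac{\sin a\pi}{a\pi}\,2\pi^{3/2}\left(\frac{2}{\sqrt{-3}}\right)^{1/2}\left(\frac{M+a}{2\pi i}\right)^{3/2}\exp\left(\frac{M+a}{2\pi i}\cdot i\operatorname{Vol}(\mathbb{S}^3\setminus 4_1)\right)$$ and $$J_M(4_1;q)\ \sim\ \frac{\sin a\pi}{a\pi}\,\frac{1}{3^{1/4}}\,(M+a)^{3/2}\exp\left(\frac{(M+a)\operatorname{Vol}(\mathbb{S}^3\setminus4_1)}{2\pi}\right),$$ where $\frac{\sin a\pi}{a\pi}$ is taken to be $1$ when $a=0$.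
   Context: $A_M\sim B_M$ means $A_M/B_M\to1$. $J_M(4_1;q)$ is the normalized $M$-th colored Jones polynomial of the figure eight knot $4_1$: $$J_M(4_1;q)=1+\sum_{k=1}^{M-1}\prod_{l=1}^{k}\left(q^{\frac{M-l}{2}}-q^{-\frac{M-l}{2}}\right)\left(q^{\frac{M+l}{2}}-q^{-\frac{M+l}{2}}\right),$$ where for $q=e^{\eta}$ one sets $q^x=e^{x\eta}$. $\operatorname{Vol}(\mathbb{S}^3\setminus4_1)$ is the hyperbolic volume of the figure eight knot complement; it equals $6\Lambda(\pi/3)=2.0298\ldots$ with $\Lambda(\theta)=-\int_0^\theta\log|2\sin t|\,dt$. Here $\sqrt{-3}=i\sqrt3$ and fractional powers are principal. *)

theory Defs
  imports
    "HOL-Analysis.Analysis"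
    "HOL-Library.Landau_Symbols"
begin

text \<open>
  The normalized \<open>M\<close>-th colored Jones polynomial of the figure eight knot at \<open>q = exp \<eta>\<close>.  Its
  argument is the logarithm \<open>\<eta>\<close> rather than \<open>q\<close>, which makes the fractional powers
  \<open>q\<^sup>x = exp (x * \<eta>)\<close> unambiguous.
\<close>

definition colored_jones_fig8 :: "nat \<Rightarrow> complex \<Rightarrow> complex" where
  "colored_jones_fig8 M \<eta> =
     (let qpow = (\<lambda>x::real. exp (complex_of_real x * \<eta>))
      in 1 + (\<Sum>k=1..M-1. \<Prod>l=1..k.
               (qpow ((real M - real l) / 2) - qpow (- ((real M - real l) / 2))) *
               (qpow ((real M + real l) / 2) - qpow (- ((real M + real l) / 2)))))"

definition Lobachevsky :: "real \<Rightarrow> real" where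
  "Lobachevsky \<theta> = - (LBINT t=0..\<theta>. ln \<bar>2 * sin t\<bar>)"

text \<open>
  The hyperbolic volume of the figure eight knot complement, given by its classical evaluation:
  the complement is a union of two regular ideal tetrahedra, each of volume
  \<open>3 * Lobachevsky (pi / 3)\<close>.
\<close>

definition vol_fig8_complement :: real where
  "vol_fig8_complement = 6 * Lobachevsky (pi / 3)"

definition sin_pi_quotient :: "real \<Rightarrow> real" where
  "sin_pi_quotient a = (if a = 0 then 1 else sin (a * pi) / (a * pi))"

end

theory Submission
  imports
    Defs
    "HOL-Probability.Distributions"
    "HOL-Computational_Algebra.Fundamental_Theorem_Algebra"
begin

text \<open>
  Write \<open>N = M + a\<close> and \<open>h = pi / N\<close>.  At \<open>q = exp (2 * pi * \<i> / N)\<close> the Jones polynomial is a sum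
  over \<open>k < M\<close> of the real products \<open>\<Prod>l=1..k. 4 * sin ((l + a) * h) * sin ((l - a) * h)\<close>
  (\<open>colored_jones_fig8_eq_sum\<close>).  From \<open>sin (x + y) * sin (x - y) = (sin x)\<^sup>2 - (sin y)\<^sup>2\<close>, each such
  product splits into \<open>\<Prod>l=1..k. (2 * sin (l * h))\<^sup>2\<close>, in which \<open>a\<close> occurs only
  through \<open>h\<close>, and a bounded correction \<open>\<Prod>l=1..k. 1 - (sin (a * h))\<^sup>2 / (sin (l * h))\<^sup>2\<close>.

  The correction tends to \<open>\<Prod>l. 1 - a\<^sup>2 / l\<^sup>2 = sin (pi * a) / (pi * a)\<close> by Tannery's theorem and
  Euler's product (\<open>shift_correction_tendsto\<close>).  For the main factor, let \<open>S\<close> be the antiderivative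
  of \<open>ln (2 * sin \<theta>)\<close> with \<open>S 0 = 0\<close>.  Comparing the sum of \<open>ln (2 * sin (l * h))\<close> with the integral by
  the midpoint rule gives
  \<open>(\<Prod>l=1..k. (2 * sin (l * h))\<^sup>2) \<approx> C * N * exp (2 * S ((k + 1/2) * h) / h)\<close>, where the errors of the
  midpoint rule are dominated by a summable sequence even at the logarithmic singularity, so
  that a universal constant \<open>C\<close> exists.  Instead of Stirling's formula, a single exact evaluation
  shows \<open>C = 1\<close>: for \<open>N = 2 * n + 1\<close> and \<open>k = n\<close> the product is exactly \<open>N\<close>, and the exponent is
  \<open>S (pi / 2) = 0\<close> (\<open>log_sine_sum_error_tendsto_0\<close>).

  The rest is Laplace's method.  The function \<open>S\<close> has its maximum at \<open>5 * pi / 6\<close>, where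
  \<open>2 * sin \<theta> = 1\<close>; there \<open>S = vol_fig8_complement / 4\<close> by the duplication and reflection formulas
  (\<open>log_sine_integral_peak\<close>), and the second derivative is \<open>- sqrt 3\<close>.  With
  \<open>k = 5 * N / 6 + sqrt N * y\<close>, the terms divided by \<open>N * exp (N * vol_fig8_complement / (2 * pi))\<close>
  converge to \<open>sin (pi * a) / (pi * a) * exp (- sqrt 3 * pi * y\<^sup>2)\<close>, and a global quadratic bound for
  \<open>S\<close> (\<open>log_sine_integral_peak_bound\<close>) supplies a Gaussian majorant.  Summation over \<open>k\<close> adds the factor
  \<open>sqrt N\<close> and the Gaussian integral \<open>3 powr (- 1/4)\<close> (\<open>sum_jones_term_tendsto\<close>).  The limit is
  nonzero because \<open>a\<close> is not a positive integer.
\<close>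

section \<open>The log-sine integral and the Lobachevsky function\<close>

text \<open>
  On the interval from \<open>0\<close> to \<open>pi\<close> this is the integral of \<open>ln (2 * sin t)\<close> from \<open>0\<close> to
  \<open>\<theta>\<close>, the negative of the Lobachevsky function, without improper integration: the logarithmic singularity at \<open>0\<close> is integrated by hand, and the remaining integrand
  \<open>ln (sin t / t)\<close> is continuous even at \<open>0\<close>, where the default values of division and \<open>ln\<close>
  give \<open>0\<close>, the correct limit.
\<close>
definition log_sine_integral :: "real \<Rightarrow> real" where
  "log_sine_integral \<theta> = \<theta> * ln (2 * \<theta>) - \<theta> + integral {0..\<theta>} (\<lambda>t. ln (sin t / t))"

lemma isCont_ln_sinc:
  fixes t :: real
  assumes "\<bar>t\<bar> < pi"
  shows "isCont (\<lambda>t. ln (sin t / t)) t"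
proof (cases "t = 0")
  case True
  have "(\<lambda>t::real. sin t / t) \<midarrow>0\<rightarrow> 1"
    using DERIV_sin[of "0::real"] by (simp add: DERIV_def)
  from tendsto_ln[OF this] show ?thesis
    by (simp add: True isCont_def)
next
  case False
  have "sin t \<noteq> 0"
    using False assms sin_gt_zero[of t] sin_gt_zero[of "-t"] by (cases "t > 0") auto
  then show ?thesis using False by (intro continuous_intros) auto
qed

lemma ln_sinc_integral_derivative:
  assumes "0 \<le> \<theta>" "\<theta> < b" "b < pi"
  shows "((\<lambda>u. integral {0..u} (\<lambda>t. ln (sin t / t))) has_real_derivative ln (sin \<theta> / \<theta>))
           (at \<theta> within {0..b})"
proof (rule integral_has_real_derivative)
  show "continuous_on {0..b} (\<lambda>t. ln (sin t / t))"
    using assms by (intro continuous_at_imp_continuous_on ballI isCont_ln_sinc) auto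
qed (use assms in auto)

lemma log_sine_integral_derivative:
  assumes "0 < \<theta>" "\<theta> < pi"
  shows "(log_sine_integral has_real_derivative ln (2 * sin \<theta>)) (at \<theta>)"
proof -
  \<comment> \<open>any right end strictly between \<open>\<theta>\<close> and \<open>pi\<close>\<close>
  define b where "b = (\<theta> + pi) / 2"
  have b: "\<theta> < b" "b < pi" using assms by (auto simp: b_def)
  have "at \<theta> within {0..b} = at \<theta>"
    using assms b by (intro at_within_interior) auto
  with ln_sinc_integral_derivative[of \<theta> b] assms b
  have I: "((\<lambda>u. integral {0..u} (\<lambda>t. ln (sin t / t))) has_real_derivative ln (sin \<theta> / \<theta>)) (at \<theta>)"
    by simp
  have "sin \<theta> > 0" using assms by (intro sin_gt_zero)
  then have eq: "ln (2 * sin \<theta>) = ln (2 * \<theta>) + ln (sin \<theta> / \<theta>)"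
    using assms by (simp add: ln_mult ln_div)
  show ?thesis
    unfolding log_sine_integral_def[abs_def] eq
    by (rule derivative_eq_intros I refl | use assms in simp)+
qed

text \<open>
  Near \<open>0\<close> the integral is \<open>\<theta> * ln (2 * \<theta>) - \<theta> + o(\<theta>)\<close>.  After division by the step \<open>h\<close>, all
  divergence as \<open>h \<rightarrow> 0\<close> sits in the explicit term \<open>c * ln h\<close>.
\<close>
lemma log_sine_integral_scaled_at_0:
  assumes "c > 0"
  shows "((\<lambda>h. log_sine_integral (c * h) / h - c * ln h) \<longlongrightarrow> c * ln (2 * c) - c) (at_right 0)"
proof -
  define H where "H = (\<lambda>u. integral {0..u} (\<lambda>t::real. ln (sin t / t)))"
  have "(H has_real_derivative 0) (at 0 within {0..1})"
    using ln_sinc_integral_derivative[of 0 1] pi_gt3 by (simp add: H_def)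
  then have "((\<lambda>u. H u / u) \<longlongrightarrow> 0) (at 0 within {0..1})"
    by (simp add: has_field_derivative_iff H_def)
  then have 1: "((\<lambda>u. H u / u) \<longlongrightarrow> 0) (at_right 0)"
    using at_within_Icc_at_right[of "0::real" 1] by simp
  have "filterlim (\<lambda>h. c * h) (at_right 0) (at_right 0)"
    using assms by real_asymp
  from tendsto_mult_right[OF filterlim_compose[OF 1 this], of c]
  have "((\<lambda>h. c * ln (2 * c) - c + c * (H (c * h) / (c * h))) \<longlongrightarrow> c * ln (2 * c) - c) (at_right 0)"
    by (auto intro!: tendsto_eq_intros)
  moreover have "eventually (\<lambda>h. c * ln (2 * c) - c + c * (H (c * h) / (c * h)) =
      log_sine_integral (c * h) / h - c * ln h) (at_right 0)"
    using eventually_at_right_less[of 0]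
  proof eventually_elim
    case (elim h)
    have "ln (2 * (c * h)) = ln (2 * c) + ln h" using elim assms by (simp add: ln_mult)
    then show ?case using elim assms
      by (simp add: log_sine_integral_def H_def field_simps)
  qed
  ultimately show ?thesis by (rule Lim_transform_eventually)
qed

lemma log_sine_integral_at_right_0: "(log_sine_integral \<longlongrightarrow> 0) (at_right 0)"
proof -
  have A: "((\<lambda>h::real. h) \<longlongrightarrow> 0) (at_right 0)" "((\<lambda>h::real. h * ln h) \<longlongrightarrow> 0) (at_right 0)"
    by real_asymp+
  have "((\<lambda>h. h * (log_sine_integral (1 * h) / h - 1 * ln h) + h * ln h) \<longlongrightarrow>
      0 * (1 * ln (2 * 1) - 1) + 0) (at_right 0)"
    by (intro tendsto_intros A log_sine_integral_scaled_at_0) auto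
  moreover have "eventually (\<lambda>h. h * (log_sine_integral (1 * h) / h - 1 * ln h) + h * ln h =
      log_sine_integral h) (at_right 0)"
    using eventually_at_right_less[of 0] by eventually_elim (auto simp: field_simps)
  ultimately show ?thesis using Lim_transform_eventually by fastforce
qed

lemma zero_derivative_imp_constant:
  fixes f :: "real \<Rightarrow> real"
  assumes "\<And>x. a < x \<Longrightarrow> x < b \<Longrightarrow> (f has_real_derivative 0) (at x)"
    and "a < x" "x < b" "a < y" "y < b"
  shows "f x = f y"
proof -
  have "\<exists>c. \<forall>x\<in>{a<..<b}. f x = c"
    by (rule has_field_derivative_zero_constant)
       (use assms(1) in \<open>auto intro: has_field_derivative_at_within\<close>)
  with assms show ?thesis by auto
qed

lemma log_sine_integral_chain:
  assumes "(g has_real_derivative g') (at x)" "0 < g x" "g x < pi"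
  shows "((\<lambda>x. log_sine_integral (g x)) has_real_derivative ln (2 * sin (g x)) * g') (at x)"
  using DERIV_chain2[OF log_sine_integral_derivative assms(1)] assms by auto

lemma isCont_log_sine_integral: "0 < x \<Longrightarrow> x < pi \<Longrightarrow> isCont log_sine_integral x"
  using DERIV_isCont log_sine_integral_derivative by blast

text \<open>
  The two integrands are mirror images, so the sum is constant.  That the constant vanishes needs
  the duplication identity as well.
\<close>
lemma log_sine_integral_reflect_aux:
  assumes "0 < x" "x < pi"
  shows "log_sine_integral (pi - x) + log_sine_integral x = 2 * log_sine_integral (pi / 2)"
proof -
  define G where "G = (\<lambda>x. log_sine_integral (pi - x) + log_sine_integral x)"
  have "G x = G (pi / 2)"
  proof (rule zero_derivative_imp_constant[where f = G and a = 0 and b = pi])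
    fix x :: real assume x: "0 < x" "x < pi"
    show "(G has_real_derivative 0) (at x)"
      unfolding G_def using x by (auto intro!: derivative_eq_intros log_sine_integral_derivative log_sine_integral_chain)
  qed (use assms in auto)
  then show ?thesis by (simp add: G_def)
qed

text \<open>
  The left-hand side is constant because \<open>2 * sin (2 * x) = (2 * sin x) * (2 * sin (x + pi / 2))\<close>;
  its value is read off as \<open>x \<rightarrow> 0\<close>.
\<close>
lemma log_sine_integral_duplicate_aux:
  assumes "0 < x" "x < pi / 2"
  shows "log_sine_integral (2 * x) - 2 * log_sine_integral x - 2 * log_sine_integral (x + pi / 2)
         = - 2 * log_sine_integral (pi / 2)"
proof -
  define G where "G = (\<lambda>x. log_sine_integral (2 * x) - 2 * log_sine_integral x
      - 2 * log_sine_integral (x + pi / 2))"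
  have "(G has_real_derivative 0) (at x)" if x: "0 < x" "x < pi / 2" for x
  proof -
    have ln4: "ln (4::real) = 2 * ln 2" using ln_mult[of 2 "2::real"] by simp
    have "sin x > 0" "cos x > 0" using x by (auto intro: sin_gt_zero cos_gt_zero)
    then have "ln (2 * sin (2 * x)) * 2 - 2 * ln (2 * sin x) - 2 * (ln (2 * sin (x + pi / 2)) * 1) = 0"
      using ln4 by (simp add: sin_double sin_add ln_mult)
    with x show ?thesis unfolding G_def
      by (auto intro!: derivative_eq_intros log_sine_integral_derivative log_sine_integral_chain)
  qed
  then have G: "G x = G y" if "0 < y" "y < pi / 2" for y
    using that assms by (intro zero_derivative_imp_constant[of 0 "pi/2"]) auto
  have f: "filterlim (\<lambda>h::real. 2 * h) (at_right 0) (at_right 0)"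
    by real_asymp
  have "((\<lambda>x. log_sine_integral (x + pi / 2)) \<longlongrightarrow> log_sine_integral (0 + pi / 2)) (at_right 0)"
    by (rule isCont_tendsto_compose[OF isCont_log_sine_integral]) (auto intro!: tendsto_eq_intros)
  then have "(G \<longlongrightarrow> 0 - 2 * 0 - 2 * log_sine_integral (0 + pi / 2)) (at_right 0)"
    unfolding G_def
    by (intro tendsto_intros log_sine_integral_at_right_0 filterlim_compose[OF log_sine_integral_at_right_0 f])
  moreover have "eventually (\<lambda>y. G y = G x) (at_right 0)"
    unfolding eventually_at_right_field using G[symmetric] pi_gt_zero
    by (intro exI[of _ "pi/2"]) auto
  then have "(G \<longlongrightarrow> G x) (at_right 0)"
    by (rule tendsto_eventually)
  ultimately have "G x = - 2 * log_sine_integral (pi / 2)"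
    using tendsto_unique[of "at_right (0::real)"] by force
  then show ?thesis by (simp add: G_def)
qed

text \<open>
  With \<open>c\<close> for the value in question, the constant in the duplication identity is \<open>-2 * c\<close> when
  computed at \<open>x = 0\<close>, and \<open>-4 * c\<close> when computed at \<open>x = pi / 2\<close> by reflection.  Hence \<open>c = 0\<close>.
\<close>
lemma log_sine_integral_half_pi [simp]: "log_sine_integral (pi / 2) = 0"
proof -
  let ?c = "log_sine_integral (pi / 2)"
  have f: "filterlim (\<lambda>h::real. 2 * h) (at_right 0) (at_right 0)"
    by real_asymp
  have c: "((\<lambda>y. log_sine_integral (pi / 2 - y)) \<longlongrightarrow> log_sine_integral (pi / 2 - 0)) (at_right 0)"
    by (rule isCont_tendsto_compose[OF isCont_log_sine_integral]) (auto intro!: tendsto_eq_intros)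
  have "((\<lambda>y. (2 * ?c - log_sine_integral (2 * y)) - 2 * log_sine_integral (pi / 2 - y)
      - 2 * (2 * ?c - log_sine_integral y)) \<longlongrightarrow> (2 * ?c - 0) - 2 * log_sine_integral (pi / 2 - 0) - 2 * (2 * ?c - 0)) (at_right 0)"
    by (intro tendsto_intros c log_sine_integral_at_right_0 filterlim_compose[OF log_sine_integral_at_right_0 f])
  moreover have "eventually (\<lambda>y. (2 * ?c - log_sine_integral (2 * y)) - 2 * log_sine_integral (pi / 2 - y)
      - 2 * (2 * ?c - log_sine_integral y) = - 2 * ?c) (at_right 0)"
    unfolding eventually_at_right_field
  proof (intro exI[of _ "pi/2"] conjI allI impI)
    fix y :: real assume y: "0 < y" "y < pi / 2"
    have "pi / 2 - y + pi / 2 = pi - y" "2 * (pi / 2 - y) = pi - 2 * y" by (auto simp: field_simps)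
    then have d: "log_sine_integral (pi - 2 * y) - 2 * log_sine_integral (pi / 2 - y)
        - 2 * log_sine_integral (pi - y) = - 2 * ?c"
      using log_sine_integral_duplicate_aux[of "pi / 2 - y"] y by (simp only:)
    have r: "log_sine_integral (pi - 2 * y) = 2 * ?c - log_sine_integral (2 * y)"
      "log_sine_integral (pi - y) = 2 * ?c - log_sine_integral y"
      using y log_sine_integral_reflect_aux[of y] log_sine_integral_reflect_aux[of "2 * y"]
      by (simp_all add: eq_diff_eq)
    show "(2 * ?c - log_sine_integral (2 * y)) - 2 * log_sine_integral (pi / 2 - y)
      - 2 * (2 * ?c - log_sine_integral y) = - 2 * ?c"
      using d unfolding r .
  qed simp
  then have "((\<lambda>y. (2 * ?c - log_sine_integral (2 * y)) - 2 * log_sine_integral (pi / 2 - y)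
      - 2 * (2 * ?c - log_sine_integral y)) \<longlongrightarrow> - 2 * ?c) (at_right 0)"
    by (rule tendsto_eventually)
  ultimately have "(2 * ?c - 0) - 2 * log_sine_integral (pi / 2 - 0) - 2 * (2 * ?c - 0) = - 2 * ?c"
    by (rule tendsto_unique[rotated]) simp
  then show ?thesis by simp
qed

lemma log_sine_integral_reflect:
  assumes "0 < x" "x < pi"
  shows "log_sine_integral (pi - x) = - log_sine_integral x"
  using log_sine_integral_reflect_aux[OF assms] by simp

text \<open>
  Duplication at \<open>pi / 6\<close> relates the values at \<open>pi / 6\<close>, \<open>pi / 3\<close> and \<open>2 * pi / 3\<close>, and reflection
  leaves a single unknown.  This is why the maximal value is a multiple of the volume of a regular
  ideal tetrahedron.
\<close>
lemma log_sine_integral_5_pi_6: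
  "log_sine_integral (5 * pi / 6) = - 3 / 2 * log_sine_integral (pi / 3)"
proof -
  have e: "pi - pi / 6 = 5 * pi / 6" "pi - pi / 3 = pi / 6 + pi / 2" "2 * (pi / 6) = pi / 3"
    by (simp_all add: field_simps)
  have "log_sine_integral (5 * pi / 6) = - log_sine_integral (pi / 6)"
    using log_sine_integral_reflect[of "pi/6", unfolded e] by simp
  moreover have "log_sine_integral (pi / 6 + pi / 2) = - log_sine_integral (pi / 3)"
    using log_sine_integral_reflect[of "pi/3", unfolded e] by simp
  moreover have "log_sine_integral (pi / 3) - 2 * log_sine_integral (pi / 6)
      - 2 * log_sine_integral (pi / 6 + pi / 2) = 0"
    using log_sine_integral_duplicate_aux[of "pi/6", unfolded e] by simp
  ultimately show ?thesis by linarith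
qed

text \<open>
  The integrand \<open>ln (2 * sin t)\<close> is unbounded at \<open>0\<close> and changes sign, so its integrability is
  derived from that of the nonnegative function \<open>- ln (sin t)\<close>.
\<close>
lemma Lobachevsky_eq:
  assumes "0 < \<theta>" "\<theta> < pi"
  shows "Lobachevsky \<theta> = - log_sine_integral \<theta>"
proof -
  have e: "einterval 0 (ereal \<theta>) = {0<..<\<theta>}"
    by (auto simp: einterval_def zero_ereal_def)
  define F where "F = (\<lambda>x. x * ln 2 - log_sine_integral x)"
  have pos: "sin x > 0" if "0 < x" "x < \<theta>" for x
    using that assms by (intro sin_gt_zero) auto
  have L: "((g \<circ> real_of_ereal) \<longlongrightarrow> A) (at_right 0)" if "(g \<longlongrightarrow> A) (at_right 0)"
    for g :: "real \<Rightarrow> real" and A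
    using that by (simp add: ereal_tendsto_simps zero_ereal_def)
  have R: "((g \<circ> real_of_ereal) \<longlongrightarrow> g \<theta>) (at_left (ereal \<theta>))" if "isCont g \<theta>"
    for g :: "real \<Rightarrow> real"
    using that filterlim_at_split[of g _ \<theta>] by (simp add: ereal_tendsto_simps isCont_def)
  have "set_integrable lborel (einterval 0 (ereal \<theta>)) (\<lambda>x. - ln (sin x))"
  proof (rule interval_integral_FTC_nonneg)
    show "DERIV F x :> - ln (sin x)" if "0 < ereal x" "ereal x < ereal \<theta>" for x
    proof -
      have x: "0 < x" "x < \<theta>" using that by (auto simp: zero_ereal_def)
      show ?thesis unfolding F_def
        using x assms pos[OF x]
        by (auto intro!: derivative_eq_intros log_sine_integral_derivative simp: ln_mult)
    qed
    show "isCont (\<lambda>x. - ln (sin x)) x" if "0 < ereal x" "ereal x < ereal \<theta>" for x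
      using pos[of x] that by (auto intro!: continuous_intros simp: zero_ereal_def)
    show "AE x in lborel. 0 < ereal x \<longrightarrow> ereal x < ereal \<theta> \<longrightarrow> 0 \<le> - ln (sin x)"
      by (intro AE_I2) (use pos in \<open>auto simp: zero_ereal_def\<close>)
    show "((F \<circ> real_of_ereal) \<longlongrightarrow> 0) (at_right 0)"
      by (rule L) (auto simp: F_def intro!: tendsto_eq_intros log_sine_integral_at_right_0)
    show "((F \<circ> real_of_ereal) \<longlongrightarrow> F \<theta>) (at_left (ereal \<theta>))"
      by (rule R) (use assms in \<open>auto simp: F_def intro!: continuous_intros isCont_log_sine_integral\<close>)
  qed (use assms in \<open>auto simp: zero_ereal_def\<close>)
  moreover have "set_integrable lborel {0<..<\<theta>} (\<lambda>x. ln 2 :: real)"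
    by (rule set_integrable_subset[OF borel_integrable_atLeastAtMost'[of 0 \<theta>]]) auto
  ultimately have si: "set_integrable lborel {0<..<\<theta>} (\<lambda>x. ln 2 - (- ln (sin x)))"
    unfolding e by (intro set_integral_diff(1))
  have "set_integrable lborel {0<..<\<theta>} (\<lambda>x. ln \<bar>2 * sin x\<bar>)"
    using si
  proof (rule set_integrable_cong[THEN iffD1, OF refl refl, rotated])
    show "ln 2 - (- ln (sin x)) = ln \<bar>2 * sin x\<bar>" if "x \<in> {0<..<\<theta>}" for x
      using pos[of x] that by (simp add: ln_mult abs_mult)
  qed
  then have "(LBINT t=0..ereal \<theta>. ln \<bar>2 * sin t\<bar>) = log_sine_integral \<theta> - 0"
  proof (intro interval_integral_FTC_integrable)
    show "(log_sine_integral has_vector_derivative ln \<bar>2 * sin x\<bar>) (at x)"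
      if "0 < ereal x" "ereal x < ereal \<theta>" for x
      using log_sine_integral_derivative[of x] that assms pos[of x]
      by (auto simp: zero_ereal_def has_real_derivative_iff_has_vector_derivative)
    show "isCont (\<lambda>x. ln \<bar>2 * sin x\<bar>) x" if "0 < ereal x" "ereal x < ereal \<theta>" for x
      using pos[of x] that by (auto intro!: continuous_intros simp: zero_ereal_def)
    show "((log_sine_integral \<circ> real_of_ereal) \<longlongrightarrow> 0) (at_right 0)"
      by (rule L) (rule log_sine_integral_at_right_0)
    show "((log_sine_integral \<circ> real_of_ereal) \<longlongrightarrow> log_sine_integral \<theta>) (at_left (ereal \<theta>))"
      by (rule R) (use assms in \<open>auto intro!: isCont_log_sine_integral\<close>)
  qed (use assms e in \<open>auto simp: zero_ereal_def\<close>)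
  then show ?thesis by (simp add: Lobachevsky_def)
qed

lemma log_sine_integral_peak: "log_sine_integral (5 * pi / 6) = vol_fig8_complement / 4"
  using log_sine_integral_5_pi_6 Lobachevsky_eq[of "pi/3"]
  by (simp add: vol_fig8_complement_def)

section \<open>Midpoint sums of the log-sine\<close>

lemma sin_lower_bound:
  assumes "0 \<le> x" "x \<le> pi"
  shows "sin x \<ge> 2 / pi * min x (pi - x)"
proof -
  have *: "sin x \<ge> 2 / pi * x" if "0 \<le> x" "x \<le> pi / 2" for x
  proof -
    have "concave_on {0..pi/2} sin"
    proof (rule f''_le0_imp_concave)
      show "\<And>x. (cos has_real_derivative - sin x) (at x)" by (rule DERIV_cos)
      show "\<And>x. x \<in> {0..pi/2} \<Longrightarrow> - sin x \<le> 0" by (auto intro!: sin_ge_zero)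
    qed (auto intro!: derivative_eq_intros)
    then have "sin ((1 - 2 / pi * x) *\<^sub>R 0 + (2 / pi * x) *\<^sub>R (pi / 2))
        \<ge> (1 - 2 / pi * x) * sin 0 + (2 / pi * x) * sin (pi / 2)"
      using that by (intro concave_onD) (auto simp: field_simps)
    then show ?thesis by simp
  qed
  show ?thesis
  proof (cases "x \<le> pi / 2")
    case True then show ?thesis using *[of x] assms by (auto simp: min_def)
  next
    case False then show ?thesis using *[of "pi - x"] assms by (auto simp: min_def)
  qed
qed

text \<open>
  Up to sign, \<open>1 / (sin x)\<^sup>2\<close> is the second derivative of \<open>ln (2 * sin x)\<close>; it controls all Taylor
  remainders below.
\<close>
lemma inverse_sin_square_bound:
  assumes "0 < x" "x < pi"
  shows "1 / (sin x)\<^sup>2 \<le> (pi\<^sup>2 / 4) * (1 / x\<^sup>2 + 1 / (pi - x)\<^sup>2)"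
proof -
  define m where "m = min x (pi - x)"
  have m: "m > 0" using assms by (auto simp: m_def)
  have "2 / pi * m \<le> sin x" using sin_lower_bound[of x] assms by (auto simp: m_def)
  then have "(2 / pi * m)\<^sup>2 \<le> (sin x)\<^sup>2" using m by (intro power_mono) auto
  then have "1 / (sin x)\<^sup>2 \<le> 1 / (2 / pi * m)\<^sup>2"
    using m sin_gt_zero[OF assms] by (intro divide_left_mono mult_pos_pos zero_less_power) auto
  also have "\<dots> = pi\<^sup>2 / 4 * (1 / m\<^sup>2)" using m by (simp add: field_simps)
  also have "1 / m\<^sup>2 \<le> 1 / x\<^sup>2 + 1 / (pi - x)\<^sup>2" by (auto simp: m_def min_def)
  finally show ?thesis by (simp add: mult_left_mono)
qed

lemma log_sine_integral_taylor:
  assumes c: "0 < c" "c < pi" and x: "0 < x" "x < pi" and "x \<noteq> c"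
  obtains t where "min c x < t" "t < max c x"
    "log_sine_integral x = log_sine_integral c + ln (2 * sin c) * (x - c)
       + cot c / 2 * (x - c)\<^sup>2 - (x - c) ^ 3 / (6 * (sin t)\<^sup>2)"
proof -
  define D where "D = (\<lambda>m. case m of 0 \<Rightarrow> log_sine_integral | Suc 0 \<Rightarrow> (\<lambda>x. ln (2 * sin x))
    | Suc (Suc 0) \<Rightarrow> (\<lambda>x::real. cot x) | _ \<Rightarrow> (\<lambda>x. - inverse ((sin x)\<^sup>2)))"
  have D: "\<forall>m t. m < 3 \<and> min c x \<le> t \<and> t \<le> max c x \<longrightarrow> DERIV (D m) t :> D (Suc m) t"
  proof (intro allI impI, elim conjE)
    fix m t assume "m < (3::nat)" and t': "min c x \<le> t" "t \<le> max c x"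
    then have t: "0 < t" "t < pi" using c x by (auto simp: min_def max_def split: if_splits)
    then have s: "sin t > 0" by (rule sin_gt_zero)
    consider "m = 0" | "m = 1" | "m = 2" using \<open>m < 3\<close> by linarith
    then show "DERIV (D m) t :> D (Suc m) t"
    proof cases
      case 1 then show ?thesis using t by (auto simp: D_def log_sine_integral_derivative)
    next
      case 2 then show ?thesis using s
        by (auto simp: D_def cot_def intro!: derivative_eq_intros)
    next
      case 3 then show ?thesis using s DERIV_cot[of t]
        by (auto simp: D_def numeral_2_eq_2)
    qed
  qed
  have "\<exists>t. min c x < t \<and> t < max c x \<and>
    log_sine_integral x = (\<Sum>m<3. (D m c / fact m) * (x - c)^m) + (D 3 t / fact 3) * (x - c)^3"
  proof (cases "x < c")
    case True
    then show ?thesis using Taylor_down[of 3 D log_sine_integral x c c] D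
      by (auto simp: D_def min_def max_def)
  next
    case False
    then have "c < x" using assms by auto
    then show ?thesis using Taylor_up[of 3 D log_sine_integral c x c] D
      by (auto simp: D_def min_def max_def)
  qed
  then obtain t where "min c x < t" "t < max c x"
    "log_sine_integral x = (\<Sum>m<3. (D m c / fact m) * (x - c)^m) + (D 3 t / fact 3) * (x - c)^3"
    by blast
  then show ?thesis
    by (intro that[of t]) (auto simp: D_def eval_nat_numeral field_simps fact_numeral)
qed

text \<open>
  In the difference of the Taylor expansions at \<open>c + d\<close> and \<open>c - d\<close> the quadratic terms cancel.
\<close>
lemma midpoint_rule_bound:
  assumes "0 < c - d" "c + d < pi" "0 < d"
    and B: "\<And>t. c - d < t \<Longrightarrow> t < c + d \<Longrightarrow> 1 / (sin t)\<^sup>2 \<le> B"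
  shows "\<bar>log_sine_integral (c + d) - log_sine_integral (c - d) - 2 * d * ln (2 * sin c)\<bar> \<le> B * d ^ 3 / 3"
proof -
  obtain t where t: "c < t" "t < c + d" "log_sine_integral (c + d) = log_sine_integral c
      + ln (2 * sin c) * d + cot c / 2 * d\<^sup>2 - d ^ 3 / (6 * (sin t)\<^sup>2)"
    using log_sine_integral_taylor[of c "c + d"] assms by (auto simp: min_def max_def)
  obtain u where u: "c - d < u" "u < c" "log_sine_integral (c - d) = log_sine_integral c
      - ln (2 * sin c) * d + cot c / 2 * d\<^sup>2 + d ^ 3 / (6 * (sin u)\<^sup>2)"
    using log_sine_integral_taylor[of c "c - d"] assms by (auto simp: min_def max_def)
  have 1: "log_sine_integral (c + d) - log_sine_integral (c - d) - 2 * d * ln (2 * sin c)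
      = - (d ^ 3 / 6 * (1 / (sin t)\<^sup>2) + d ^ 3 / 6 * (1 / (sin u)\<^sup>2))"
    unfolding t u by (simp add: field_simps)
  have "d ^ 3 / 6 * (1 / (sin t)\<^sup>2) \<le> d ^ 3 / 6 * B" "d ^ 3 / 6 * (1 / (sin u)\<^sup>2) \<le> d ^ 3 / 6 * B"
    using assms t u by (intro mult_left_mono B; simp)+
  moreover have "d ^ 3 / 6 * (1 / (sin t)\<^sup>2) \<ge> 0" "d ^ 3 / 6 * (1 / (sin u)\<^sup>2) \<ge> 0"
    using assms by auto
  moreover have "B * d ^ 3 / 3 = d ^ 3 / 6 * B + d ^ 3 / 6 * B" by simp
  ultimately show ?thesis unfolding 1 by linarith
qed

text \<open>
  The error of the midpoint rule for \<open>ln (2 * sin \<theta>)\<close> on the cell of width \<open>h\<close> around \<open>l * h\<close>,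
  divided by \<open>h\<close>.  With midpoints, the sum over \<open>l \<le> k\<close> telescopes to the value of the integral at
  \<open>(k + 1/2) * h\<close> and no boundary term depending on \<open>k\<close> remains.
\<close>
definition midpoint_defect :: "real \<Rightarrow> nat \<Rightarrow> real" where
  "midpoint_defect h l = ln (2 * sin (l * h))
     - (log_sine_integral ((l + 1/2) * h) - log_sine_integral ((l - 1/2) * h)) / h"

text \<open>
  With \<open>N = pi / h\<close> this is \<open>1 / l\<^sup>2 + 1 / (N - l)\<^sup>2\<close>, the growth of \<open>h\<^sup>2 / (sin (l * h))\<^sup>2\<close> towards
  the two ends of the interval from \<open>0\<close> to \<open>pi\<close>.  Its sums over \<open>l\<close> are bounded uniformly in
  \<open>h\<close>, and away from \<open>N\<close> it is dominated by a multiple of \<open>1 / l\<^sup>2\<close>.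
\<close>
definition edge_bound :: "real \<Rightarrow> nat \<Rightarrow> real" where
  "edge_bound h l = 1 / (real l)\<^sup>2 + 1 / (pi / h - l)\<^sup>2"

lemma edge_bound_nonneg: "edge_bound h l \<ge> 0"
  by (simp add: edge_bound_def)

lemma inverse_sin_square_edge_bound:
  assumes h: "0 < h" and l: "1 \<le> l" "(l + 1) * h \<le> pi"
    and t: "(l - 1/2) * h \<le> t" "t \<le> (l + 1/2) * h"
  shows "1 / (sin t)\<^sup>2 \<le> pi\<^sup>2 / h\<^sup>2 * edge_bound h l"
proof -
  have lh: "h \<le> real l * h" using l h by simp
  have th: "real l * h - h / 2 \<le> t" "t \<le> real l * h + h / 2" "real l * h + h \<le> pi"
    using t l by (auto simp: algebra_simps)
  have t0: "l * h / 2 \<le> t" "(pi - l * h) / 2 \<le> pi - t" "0 < real l * h" "0 < pi - l * h"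
    subgoal using th lh by linarith
    subgoal using th by (simp add: field_simps)
    subgoal using h lh by linarith
    subgoal using h th by linarith
    done
  have "1 / (sin t)\<^sup>2 \<le> (pi\<^sup>2 / 4) * (1 / t\<^sup>2 + 1 / (pi - t)\<^sup>2)"
  proof (rule inverse_sin_square_bound)
    show "0 < t" using t0 by linarith
    show "t < pi" using th h by linarith
  qed
  also have "\<dots> \<le> (pi\<^sup>2 / 4) * (1 / (l * h / 2)\<^sup>2 + 1 / ((pi - l * h) / 2)\<^sup>2)"
    using t0 by (intro mult_left_mono add_mono divide_left_mono power_mono mult_pos_pos
          zero_less_power) auto
  also have "\<dots> = pi\<^sup>2 * (1 / (l * h)\<^sup>2 + 1 / (pi - l * h)\<^sup>2)"
    by (simp add: field_simps)
  also have "(pi - l * h)\<^sup>2 = h\<^sup>2 * (pi / h - l)\<^sup>2"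
    using h by (simp add: power_mult_distrib[symmetric] field_simps)
  also have "pi\<^sup>2 * (1 / (real l * h)\<^sup>2 + 1 / (h\<^sup>2 * (pi / h - real l)\<^sup>2)) = pi\<^sup>2 / h\<^sup>2 * edge_bound h l"
    by (simp add: edge_bound_def power_mult_distrib distrib_left mult.commute)
  finally show ?thesis .
qed

lemma midpoint_defect_bound:
  assumes h: "0 < h" and l: "1 \<le> l" "(l + 1) * h \<le> pi"
  shows "\<bar>midpoint_defect h l\<bar> \<le> pi\<^sup>2 * edge_bound h l"
proof -
  let ?D = "log_sine_integral (l * h + h / 2) - log_sine_integral (l * h - h / 2) - 2 * (h / 2) * ln (2 * sin (l * h))"
  have lh: "h * 1 \<le> h * real l" using l h by (intro mult_left_mono) auto
  have "\<bar>?D\<bar> \<le> (pi\<^sup>2 / h\<^sup>2 * edge_bound h l) * (h / 2) ^ 3 / 3"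
  proof (rule midpoint_rule_bound)
    fix t assume "l * h - h / 2 < t" "t < l * h + h / 2"
    then show "1 / (sin t)\<^sup>2 \<le> pi\<^sup>2 / h\<^sup>2 * edge_bound h l"
      using h l by (intro inverse_sin_square_edge_bound) (auto simp: algebra_simps)
  qed (use h l lh in \<open>auto simp: algebra_simps\<close>)
  also have "\<dots> = h * (pi\<^sup>2 * edge_bound h l) / 24"
    using h by (simp add: field_simps eval_nat_numeral)
  also have "\<dots> \<le> h * (pi\<^sup>2 * edge_bound h l)"
    using h edge_bound_nonneg[of h l] by (simp add: field_simps)
  finally have "\<bar>?D\<bar> \<le> h * (pi\<^sup>2 * edge_bound h l)" .
  moreover have "?D = - (h * midpoint_defect h l)"
    using h by (simp add: midpoint_defect_def field_simps)
  ultimately show ?thesis using h by (simp add: abs_mult)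
qed

lemma sum_edge_bound_le:
  assumes h: "0 < h" and k: "(k + 1) * h \<le> pi"
  shows "(\<Sum>l=1..k. edge_bound h l) \<le> pi\<^sup>2 / 3"
proof -
  have S: "(\<Sum>l=1..k. 1 / (real l)\<^sup>2) \<le> pi\<^sup>2 / 6"
  proof -
    have "(\<Sum>l=1..k. 1 / (real l)\<^sup>2) = (\<Sum>n<k. 1 / (real n + 1)\<^sup>2)"
      by (rule sum.reindex_bij_witness[of _ Suc "\<lambda>n. n - 1"]) auto
    also have "\<dots> \<le> pi\<^sup>2 / 6"
      using sum_le_suminf[of "\<lambda>n. 1 / (real n + 1)\<^sup>2" "{..<k}"] inverse_squares_sums
      by (auto simp: sums_iff add_ac)
    finally show ?thesis .
  qed
  have "(\<Sum>l=1..k. 1 / (pi / h - l)\<^sup>2) \<le> (\<Sum>l=1..k. 1 / (real (k + 1 - l))\<^sup>2)"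
  proof (rule sum_mono)
    fix l assume l: "l \<in> {1..k}"
    have "real (k + 1) \<le> pi / h" using h k by (simp add: field_simps)
    then have "real (k + 1 - l) \<le> pi / h - l" using l by (simp add: of_nat_diff)
    moreover have "real (k + 1 - l) > 0" using l by auto
    ultimately show "1 / (pi / h - l)\<^sup>2 \<le> 1 / (real (k + 1 - l))\<^sup>2"
      by (intro divide_left_mono power_mono mult_pos_pos zero_less_power) linarith+
  qed
  also have "\<dots> = (\<Sum>l=1..k. 1 / (real l)\<^sup>2)"
    by (rule sum.reindex_bij_witness[of _ "\<lambda>l. k + 1 - l" "\<lambda>l. k + 1 - l"]) auto
  finally show ?thesis using S by (simp add: edge_bound_def sum.distrib)
qed

text \<open>
  The defect of the approximation
  \<open>(\<Prod>l=1..k. 2 * sin (l * h)) \<approx> sqrt (pi / h) * exp (log_sine_integral ((k + 1/2) * h) / h)\<close>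
  on the logarithmic scale.
\<close>
definition log_sine_sum_error :: "real \<Rightarrow> nat \<Rightarrow> real" where
  "log_sine_sum_error h k = (\<Sum>l=1..k. ln (2 * sin (real l * h)))
     - log_sine_integral ((k + 1/2) * h) / h - ln (pi / h) / 2"

lemma log_sine_sum_error_eq:
  assumes "h > 0"
  shows "log_sine_sum_error h k =
    (\<Sum>l=1..k. midpoint_defect h l) - (log_sine_integral (1/2 * h) / h - 1/2 * ln h) - ln pi / 2"
proof -
  have "(\<Sum>l=1..k. (log_sine_integral ((l + 1/2) * h) - log_sine_integral ((l - 1/2) * h)) / h)
     = (log_sine_integral ((k + 1/2) * h) - log_sine_integral (1/2 * h)) / h"
    by (induction k) (simp_all add: diff_divide_distrib add_ac)
  then have "(\<Sum>l=1..k. midpoint_defect h l) = (\<Sum>l=1..k. ln (2 * sin (real l * h)))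
     - (log_sine_integral ((k + 1/2) * h) - log_sine_integral (1/2 * h)) / h"
    by (simp add: midpoint_defect_def sum_subtractf)
  then show ?thesis using assms
    by (simp add: log_sine_sum_error_def ln_div diff_divide_distrib)
qed

text \<open>
  The coefficients \<open>1\<close>, \<open>l + 1/2\<close> and \<open>l - 1/2\<close> of \<open>ln h\<close> in the three terms of the defect cancel,
  so each fixed term has a limit although the sample point tends to the singularity.
\<close>
lemma midpoint_defect_tendsto:
  assumes "1 \<le> l"
  shows "\<exists>b. ((\<lambda>h. midpoint_defect h l) \<longlongrightarrow> b) (at_right 0)"
proof -
  let ?S = "\<lambda>c h::real. log_sine_integral (c * h) / h - c * ln h"
  have 1: "((\<lambda>h::real. ln (2 * sin (l * h)) - ln h) \<longlongrightarrow> ln (2 * l)) (at_right 0)"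
    using assms by real_asymp
  have 2: "(?S (l + 1/2) \<longlongrightarrow> (l + 1/2) * ln (2 * (l + 1/2)) - (l + 1/2)) (at_right 0)"
    "(?S (l - 1/2) \<longlongrightarrow> (l - 1/2) * ln (2 * (l - 1/2)) - (l - 1/2)) (at_right 0)"
    using assms by (intro log_sine_integral_scaled_at_0; simp)+
  note tendsto_diff[OF 1 tendsto_diff[OF 2]]
  moreover have "(\<lambda>h::real. (ln (2 * sin (l * h)) - ln h) - (?S (l + 1/2) h - ?S (l - 1/2) h))
     = (\<lambda>h. midpoint_defect h l)"
    by (auto simp: midpoint_defect_def fun_eq_iff algebra_simps diff_divide_distrib)
  ultimately show ?thesis by auto
qed

section \<open>Convergence of the midpoint error\<close>

text \<open>
  Dominated convergence for sums with a growing number of terms.  The limit is described by \<open>g\<close>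
  alone, so it does not depend on how fast \<open>k n\<close> grows.
\<close>
lemma tannery_partial_sums:
  fixes f :: "nat \<Rightarrow> nat \<Rightarrow> real"
  assumes k: "filterlim k at_top sequentially"
    and lim: "\<And>l. l \<ge> 1 \<Longrightarrow> (\<lambda>n. f n l) \<longlonglongrightarrow> g l"
    and bound: "eventually (\<lambda>n. \<forall>l\<in>{1..k n}. \<bar>f n l\<bar> \<le> C / (real l)\<^sup>2) sequentially"
    and C: "C \<ge> 0"
  obtains S where "(\<lambda>m. \<Sum>l=1..m. g l) \<longlonglongrightarrow> S" "(\<lambda>n. \<Sum>l=1..k n. f n l) \<longlonglongrightarrow> S"
proof -
  define a where "a = (\<lambda>l n. if Suc l \<le> k n then f n (Suc l) else 0)"
  have "(\<lambda>n. a l n) \<longlonglongrightarrow> g (Suc l)" for l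
  proof -
    have "eventually (\<lambda>n. Suc l \<le> k n) sequentially"
      using k by (simp add: filterlim_at_top)
    then have "eventually (\<lambda>n. f n (Suc l) = a l n) sequentially"
      by eventually_elim (simp add: a_def)
    then show ?thesis using lim[of "Suc l"] by (simp add: Lim_transform_eventually)
  qed
  moreover have "eventually (\<lambda>(l, n). norm (a l n) \<le> C / (real l + 1)\<^sup>2) (at_top \<times>\<^sub>F sequentially)"
  proof -
    have "eventually (\<lambda>n. \<forall>l. norm (a l n) \<le> C / (real l + 1)\<^sup>2) sequentially"
      using bound
    proof eventually_elim
      case (elim n)
      show ?case
      proof
        fix l
        show "norm (a l n) \<le> C / (real l + 1)\<^sup>2"
          using bspec[OF elim, of "Suc l"] C by (auto simp: a_def add_ac)
      qed
    qed
    from eventually_prodI[OF always_eventually[of "\<lambda>_. True"] this] show ?thesis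
      by (rule eventually_mono) auto
  qed
  moreover have "summable (\<lambda>l. C / (real l + 1)\<^sup>2)"
    using summable_mult[OF sums_summable[OF inverse_squares_sums], of C] by (simp add: add_ac)
  ultimately have T: "summable (\<lambda>l. norm (g (Suc l)))" "(\<lambda>n. \<Sum>l. a l n) \<longlonglongrightarrow> (\<Sum>l. g (Suc l))"
    using tannerys_theorem[of a "\<lambda>l. g (Suc l)" sequentially] by auto
  have shift: "(\<Sum>l<m. F (Suc l)) = (\<Sum>l=1..m. F l)" for F :: "nat \<Rightarrow> real" and m
    by (rule sum.reindex_bij_witness[of _ "\<lambda>l. l - 1" Suc]) auto
  have "(\<Sum>l. a l n) = (\<Sum>l=1..k n. f n l)" for n
  proof -
    have "(\<Sum>l. a l n) = (\<Sum>l<k n. a l n)"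
      by (rule suminf_finite) (auto simp: a_def)
    also have "\<dots> = (\<Sum>l<k n. f n (Suc l))" by (intro sum.cong) (auto simp: a_def)
    finally show ?thesis by (simp only: shift)
  qed
  moreover have "(\<lambda>m. \<Sum>l=1..m. g l) \<longlonglongrightarrow> (\<Sum>l. g (Suc l))"
    using summable_LIMSEQ[OF summable_norm_cancel[OF T(1)]] by (simp only: shift)
  ultimately show ?thesis using that T(2) by simp
qed

lemma edge_bound_interior:
  assumes h: "h > 0" and l: "1 \<le> l" "l \<le> k" and k: "real k * h \<le> 9/10 * pi"
  shows "edge_bound h l \<le> 82 / (real l)\<^sup>2"
proof -
  have "real l * h \<le> real k * h" using l h by (intro mult_right_mono) auto
  then have "real l * h * (10/9) \<le> pi" using k by simp
  then have "real l * (10/9) \<le> pi / h" using h by (simp add: field_simps)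
  then have 1: "real l / 9 \<le> pi / h - l" by simp
  have "0 < real l / 9" using l by simp
  with 1 have "0 < pi / h - l" by (rule less_le_trans[rotated])
  with 1 have "1 / (pi / h - l)\<^sup>2 \<le> 1 / (real l / 9)\<^sup>2"
    using l by (intro divide_left_mono power_mono mult_pos_pos zero_less_power) auto
  then show ?thesis by (simp add: edge_bound_def power_divide field_simps)
qed

text \<open>
  Step sizes and summation limits for which the summation range exhausts the positive integers but
  the angle \<open>k n * h n\<close> keeps a distance from \<open>pi\<close>.  The bound \<open>9/10\<close> leaves room for the angle
  \<open>5 * pi / 6\<close>, where the terms of the Jones sum are largest.
\<close>
locale interior_sequence =
  fixes h :: "nat \<Rightarrow> real" and k :: "nat \<Rightarrow> nat"
  assumes h: "filterlim h (at_right 0) sequentially"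
    and k: "filterlim k at_top sequentially"
    and interior: "eventually (\<lambda>n. real (k n) * h n \<le> 9/10 * pi) sequentially"
begin

lemma h_pos: "eventually (\<lambda>n. h n > 0) sequentially"
  using h by (auto simp: filterlim_at eventually_conj_iff)

lemma eventually_admissible:
  "eventually (\<lambda>n. h n > 0 \<and> real (k n) * h n \<le> 9/10 * pi \<and> (real (k n) + 1) * h n \<le> pi) sequentially"
proof -
  have "eventually (\<lambda>x::real. x \<le> pi / 10) (at_right 0)"
    unfolding eventually_at_right_field by (intro exI[of _ "pi/10"]) auto
  then have "eventually (\<lambda>n. h n \<le> pi / 10) sequentially"
    using h by (rule eventually_compose_filterlim)
  with h_pos interior show ?thesis
    by eventually_elim (auto simp: algebra_simps)
qed

lemma tannery_edge_bound:
  fixes f :: "real \<Rightarrow> nat \<Rightarrow> real"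
  assumes lim: "\<And>l. l \<ge> 1 \<Longrightarrow> ((\<lambda>h. f h l) \<longlongrightarrow> g l) (at_right 0)"
    and bound: "\<And>h l. h > 0 \<Longrightarrow> l \<ge> 1 \<Longrightarrow> (real l + 1) * h \<le> pi \<Longrightarrow> \<bar>f h l\<bar> \<le> C * edge_bound h l"
    and C: "C \<ge> 0"
  obtains S where "(\<lambda>m. \<Sum>l=1..m. g l) \<longlonglongrightarrow> S" "(\<lambda>n. \<Sum>l=1..k n. f (h n) l) \<longlonglongrightarrow> S"
proof (rule tannery_partial_sums[OF k, of "\<lambda>n l. f (h n) l" g "C * 82"])
  show "(\<lambda>n. f (h n) l) \<longlonglongrightarrow> g l" if "l \<ge> 1" for l
    by (rule filterlim_compose[OF lim[OF that] h])
  show "eventually (\<lambda>n. \<forall>l\<in>{1..k n}. \<bar>f (h n) l\<bar> \<le> C * 82 / (real l)\<^sup>2) sequentially"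
    using eventually_admissible
  proof eventually_elim
    case (elim n)
    show ?case
    proof
      fix l assume l: "l \<in> {1..k n}"
      have "(real l + 1) * h n \<le> (real (k n) + 1) * h n" using l elim by (intro mult_right_mono) auto
      then have "(real l + 1) * h n \<le> pi" using elim by (meson order_trans)
      then have "\<bar>f (h n) l\<bar> \<le> C * edge_bound (h n) l" using l elim by (intro bound) auto
      also have "\<dots> \<le> C * (82 / (real l)\<^sup>2)"
        using C l elim by (intro mult_left_mono edge_bound_interior) auto
      finally show "\<bar>f (h n) l\<bar> \<le> C * 82 / (real l)\<^sup>2" by simp
    qed
  qed
qed (use C that in auto)

end

lemma log_sine_integral_half_step:
  "((\<lambda>h. log_sine_integral (1/2 * h) / h - 1/2 * ln h) \<longlongrightarrow> - 1/2) (at_right 0)"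
  using log_sine_integral_scaled_at_0[of "1/2"] by simp

text \<open>
  By Tannery's theorem the limit is the same for all interior sequences.  It is thus enough to
  find one sequence along which the error is known.
\<close>
lemma log_sine_sum_error_convergent:
  "\<exists>c. \<forall>h k. interior_sequence h k \<longrightarrow> (\<lambda>n. log_sine_sum_error (h n) (k n)) \<longlonglongrightarrow> c"
proof -
  define g where "g = (\<lambda>l. Lim (at_right 0) (\<lambda>h. midpoint_defect h l))"
  have g: "((\<lambda>h. midpoint_defect h l) \<longlongrightarrow> g l) (at_right 0)" if "1 \<le> l" for l
    using midpoint_defect_tendsto[OF that] tendsto_Lim[of "at_right (0::real)"]
    by (auto simp: g_def)
  define S where "S = lim (\<lambda>m. \<Sum>l=1..m. g l)"
  have "(\<lambda>n. log_sine_sum_error (h n) (k n)) \<longlonglongrightarrow> S - (- 1/2) - ln pi / 2"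
    if "interior_sequence h k" for h k
  proof -
    interpret interior_sequence h k by fact
    obtain S' where S': "(\<lambda>m. \<Sum>l=1..m. g l) \<longlonglongrightarrow> S'"
      "(\<lambda>n. \<Sum>l=1..k n. midpoint_defect (h n) l) \<longlonglongrightarrow> S'"
    proof (rule tannery_edge_bound[of midpoint_defect g "pi\<^sup>2"])
      show "\<bar>midpoint_defect h l\<bar> \<le> pi\<^sup>2 * edge_bound h l"
        if "h > 0" "l \<ge> 1" "(real l + 1) * h \<le> pi" for h l
        using that by (intro midpoint_defect_bound) (auto simp: add_ac)
    qed (use g in auto)
    then have "S' = S" by (simp add: S_def limI)
    with S' have "(\<lambda>n. (\<Sum>l=1..k n. midpoint_defect (h n) l)
        - (log_sine_integral (1/2 * h n) / h n - 1/2 * ln (h n)) - ln pi / 2) \<longlonglongrightarrow> S - (- 1/2) - ln pi / 2"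
      by (intro tendsto_diff tendsto_const filterlim_compose[OF log_sine_integral_half_step h]) auto
    moreover have "eventually (\<lambda>n. (\<Sum>l=1..k n. midpoint_defect (h n) l)
        - (log_sine_integral (1/2 * h n) / h n - 1/2 * ln (h n)) - ln pi / 2
        = log_sine_sum_error (h n) (k n)) sequentially"
      using h_pos by eventually_elim (simp only: log_sine_sum_error_eq)
    ultimately show ?thesis by (rule Lim_transform_eventually)
  qed
  then show ?thesis by blast
qed

section \<open>The constant from a product of sines\<close>

text \<open>
  Evaluate \<open>1 + X + \<dots> + X ^ (N - 1) = (\<Prod>l=1..<N. X - w ^ l)\<close> at \<open>X = 1\<close>, where \<open>w\<close> is a primitive
  \<open>N\<close>-th root of unity, and use \<open>norm (1 - w ^ l) = 2 * sin (l * pi / N)\<close>.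
\<close>
lemma prod_two_sin:
  assumes "N \<ge> 1"
  shows "(\<Prod>l=1..<N. 2 * sin (real l * pi / real N)) = real N"
proof -
  define w where "w = (\<lambda>l::nat. exp (2 * of_real pi * \<i> * of_nat l / of_nat N) :: complex)"
  define p :: "complex poly" where "p = monom 1 N - 1"
  define q :: "complex poly" where "q = (\<Sum>j<N. monom 1 j)"
  have N: "N \<noteq> 0" using assms by simp
  have deg: "degree p = N" "lead_coeff p = 1"
  proof -
    have "degree (monom (1::complex) N) = N" by (simp add: degree_monom_eq)
    then have "degree (monom 1 N + (- 1 :: complex poly)) = N" using N
      by (subst degree_add_eq_left) auto
    then have *: "degree p = N" by (simp add: p_def)
    then show "degree p = N" "lead_coeff p = 1" using N by (auto simp: p_def)
  qed
  have poly_p: "poly p z = z ^ N - 1" for z by (simp add: p_def poly_monom)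
  have notin: "1 \<notin> w ` {1..<N}"
  proof
    assume "1 \<in> w ` {1..<N}"
    then obtain j where "j \<in> {1..<N}" "w j = 1" by force
    with complex_root_unity_eq_1[of N j] assms show False by (auto simp: w_def dest: dvd_imp_le)
  qed
  have "rsquarefree p"
    unfolding rsquarefree_roots
    by (auto simp: poly_p) (use N in \<open>auto simp: p_def pderiv_diff pderiv_monom poly_monom power_0_left\<close>)
  from complex_poly_decompose_rsquarefree[OF this]
  have p1: "p = (\<Prod>z|z ^ N = 1. [:-z, 1:])" unfolding deg(2) by (simp add: poly_p)
  have roots: "{z::complex. z ^ N = 1} = insert 1 (w ` {1..<N})"
  proof -
    have "{..<N} = insert 0 {1..<N}" using N by auto
    moreover have "{z::complex. z ^ N = 1} = w ` {..<N}"
      unfolding complex_roots_unity[OF assms] w_def by blast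
    moreover have "w 0 = 1" by (simp add: w_def)
    ultimately show ?thesis by (simp only: image_insert)
  qed
  have inj: "inj_on w {1..<N}"
    using bij_betw_roots_unity[of N] unfolding w_def bij_betw_def
    by (rule_tac inj_on_subset[of _ "{..<N}"]) auto
  have p: "p = [:-1, 1:] * (\<Prod>l=1..<N. [:-w l, 1:])"
    unfolding p1 roots prod.insert[OF finite_imageI[OF finite_atLeastLessThan] notin]
    by (simp only: prod.reindex[OF inj] o_def)
  have "p = [:-1, 1:] * q"
  proof -
    have "poly p = poly ([:-1, 1:] * q)"
    proof
      fix z :: complex
      have "poly q z = (\<Sum>j<N. z ^ j)" by (simp add: q_def poly_sum poly_monom)
      then show "poly p z = poly ([:-1, 1:] * q) z"
        using power_diff_1_eq[of z N] by (simp add: poly_p left_diff_distrib)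
    qed
    then show ?thesis by (simp add: poly_eq_poly_eq_iff)
  qed
  with p have "q = (\<Prod>l=1..<N. [:-w l, 1:])" by (metis mult_left_cancel pCons_eq_0_iff zero_neq_one)
  then have "poly q 1 = (\<Prod>l=1..<N. 1 - w l)" by (simp add: poly_prod)
  then have "of_nat N = (\<Prod>l=1..<N. 1 - w l)" by (simp add: q_def poly_sum poly_monom)
  then have "norm (of_nat N :: complex) = norm (\<Prod>l=1..<N. 1 - w l)" by (simp only:)
  then have "real N = (\<Prod>l=1..<N. norm (1 - w l))" by (simp add: prod_norm)
  also have "\<dots> = (\<Prod>l=1..<N. 2 * sin (real l * pi / real N))"
  proof (rule prod.cong)
    fix l assume l: "l \<in> {1..<N}"
    define x where "x = real l * pi / real N"
    have "w l = cis x * cis x"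
      by (simp add: w_def x_def cis_conv_exp exp_add[symmetric] field_simps)
    also have "1 = cis x * cis (- x)" by (simp add: cis_mult)
    ultimately have "1 - w l = cis x * (cis (-x) - cis x)" by (simp add: right_diff_distrib)
    also have "cis (-x) - cis x = - 2 * \<i> * of_real (sin x)"
      by (simp add: complex_eq_iff)
    finally have "norm (1 - w l) = 2 * \<bar>sin x\<bar>" by (simp add: norm_mult)
    moreover have "sin x > 0"
      using l by (intro sin_gt_zero) (auto simp: x_def field_simps)
    ultimately show "norm (1 - w l) = 2 * sin (real l * pi / real N)" by (simp add: x_def)
  qed auto
  finally show ?thesis by simp
qed

lemma odd_angle_bounds:
  assumes "1 \<le> l" "l \<le> n"
  shows "0 < real l * pi / real (2 * n + 1)" "real l * pi / real (2 * n + 1) < pi"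
proof -
  have "real l * pi < real (2 * n + 1) * pi" using assms by (intro mult_strict_right_mono) auto
  then show "real l * pi / real (2 * n + 1) < pi" by (simp add: divide_less_eq mult.commute)
qed (use assms in auto)

lemma prod_two_sin_half:
  "(\<Prod>l=1..n. 2 * sin (real l * pi / real (2 * n + 1))) = sqrt (real (2 * n + 1))"
proof -
  let ?f = "\<lambda>l. 2 * sin (real l * pi / real (2 * n + 1))"
  \<comment> \<open>\<open>l \<mapsto> 2 * n + 1 - l\<close> maps the lower half of the full product to the upper half\<close>
  have "(\<Prod>l=1..<2*n+1. ?f l) = (\<Prod>l\<in>{1..n} \<union> {n+1..2*n}. ?f l)"
    by (intro prod.cong) auto
  also have "\<dots> = (\<Prod>l=1..n. ?f l) * (\<Prod>l=n+1..2*n. ?f l)"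
    by (rule prod.union_disjoint) auto
  also have "(\<Prod>l=n+1..2*n. ?f l) = (\<Prod>l=1..n. ?f l)"
  proof (rule prod.reindex_bij_witness[of _ "\<lambda>l. 2*n+1-l" "\<lambda>l. 2*n+1-l"])
    fix l assume l: "l \<in> {n+1..2*n}"
    have "real (2*n+1-l) * pi / real (2*n+1) = pi - real l * pi / real (2*n+1)"
      using l by (simp add: of_nat_diff field_simps)
    then show "?f (2*n+1-l) = ?f l" by (simp only: sin_pi_minus)
  qed auto
  finally have "(\<Prod>l=1..n. ?f l) * (\<Prod>l=1..n. ?f l) = real (2 * n + 1)"
    using prod_two_sin[of "2*n+1"] by simp
  moreover have "(\<Prod>l=1..n. ?f l) \<ge> 0"
    using odd_angle_bounds by (intro prod_nonneg ballI less_imp_le mult_pos_pos sin_gt_zero) auto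
  ultimately show ?thesis by (metis real_sqrt_unique power2_eq_square)
qed

text \<open>
  For \<open>k = n\<close> the angle \<open>(k + 1/2) * h\<close> is exactly \<open>pi / 2\<close>, where the log-sine integral vanishes,
  and the half product of sines is known in closed form.
\<close>
lemma log_sine_sum_error_exact: "log_sine_sum_error (pi / real (2 * n + 1)) n = 0"
proof -
  let ?f = "\<lambda>l. 2 * sin (real l * pi / real (2 * n + 1))"
  have "(\<Sum>l=1..n. ln (?f l)) = ln (\<Prod>l=1..n. ?f l)"
  proof (rule ln_prod[of "{1..n}" ?f, symmetric])
    fix l assume "l \<in> {1..n}"
    then have "sin (real l * pi / real (2 * n + 1)) > 0"
      using odd_angle_bounds[of l n] by (intro sin_gt_zero) auto
    then show "?f l \<noteq> 0" by simp
  qed simp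
  also have "\<dots> = ln (real (2 * n + 1)) / 2"
    unfolding prod_two_sin_half by (rule ln_sqrt) simp
  finally have S: "(\<Sum>l=1..n. ln (2 * sin (real l * (pi / real (2 * n + 1))))) = ln (real (2 * n + 1)) / 2"
    by (simp only: times_divide_eq_right)
  have mid: "(real n + 1/2) * (pi / real (2 * n + 1)) = pi / 2"
    by (simp add: field_simps)
  show ?thesis unfolding log_sine_sum_error_def S mid by simp
qed

lemma interior_sequence_odd: "interior_sequence (\<lambda>n. pi / real (2 * n + 1)) (\<lambda>n. n)"
proof
  show "filterlim (\<lambda>n. pi / real (2 * n + 1)) (at_right 0) sequentially" by real_asymp
  show "eventually (\<lambda>n. real n * (pi / real (2 * n + 1)) \<le> 9/10 * pi) sequentially"
    by (intro always_eventually allI) (simp add: field_simps)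
qed (rule filterlim_ident)

lemma (in interior_sequence) log_sine_sum_error_tendsto_0:
  "(\<lambda>n. log_sine_sum_error (h n) (k n)) \<longlonglongrightarrow> 0"
proof -
  obtain c where c: "\<And>h k. interior_sequence h k \<Longrightarrow> (\<lambda>n. log_sine_sum_error (h n) (k n)) \<longlonglongrightarrow> c"
    using log_sine_sum_error_convergent by blast
  from c[OF interior_sequence_odd] have "c = 0"
    unfolding log_sine_sum_error_exact by (simp add: LIMSEQ_const_iff)
  with c[OF interior_sequence_axioms] show ?thesis by simp
qed

text \<open>
  Unlike the limit, the bound is uniform up to the right end of the range: it is used to dominate
  all terms of the Jones sum, not only those near the largest one.
\<close>
lemma log_sine_sum_error_bounded:
  obtains C where "eventually (\<lambda>h. \<forall>k. (real k + 1) * h \<le> pi \<longrightarrow> \<bar>log_sine_sum_error h k\<bar> \<le> C) (at_right 0)"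
proof
  have "eventually (\<lambda>h. dist (log_sine_integral (1/2 * h) / h - 1/2 * ln h) (- 1/2) < 1) (at_right 0)"
    using tendstoD[OF log_sine_integral_half_step, of 1] by simp
  then show "eventually (\<lambda>h. \<forall>k. (real k + 1) * h \<le> pi \<longrightarrow>
      \<bar>log_sine_sum_error h k\<bar> \<le> pi\<^sup>2 * (pi\<^sup>2 / 3) + (3 / 2 + \<bar>ln pi\<bar> / 2)) (at_right 0)"
    using eventually_at_right_less[of 0]
  proof eventually_elim
    case (elim h)
    show ?case
    proof (intro allI impI)
      fix k assume k: "(real k + 1) * h \<le> pi"
      have "\<bar>\<Sum>l=1..k. midpoint_defect h l\<bar> \<le> (\<Sum>l=1..k. pi\<^sup>2 * edge_bound h l)"
      proof (rule order_trans[OF sum_abs], rule sum_mono, rule midpoint_defect_bound)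
        fix l assume l: "l \<in> {1..k}"
        have "(real l + 1) * h \<le> (real k + 1) * h" using l elim by (intro mult_right_mono) auto
        then show "(real l + 1) * h \<le> pi" using k by (meson order_trans)
      qed (use elim in auto)
      also have "\<dots> \<le> pi\<^sup>2 * (pi\<^sup>2 / 3)"
        unfolding sum_distrib_left[symmetric] using elim k
        by (intro mult_left_mono sum_edge_bound_le) (auto simp: add_ac)
      finally have 1: "\<bar>\<Sum>l=1..k. midpoint_defect h l\<bar> \<le> pi\<^sup>2 * (pi\<^sup>2 / 3)" .
      have 2: "\<bar>(log_sine_integral (1/2 * h) / h - 1/2 * ln h) + 1/2\<bar> < 1"
        using elim(1) by (simp add: dist_real_def)
      show "\<bar>log_sine_sum_error h k\<bar> \<le> pi\<^sup>2 * (pi\<^sup>2 / 3) + (3 / 2 + \<bar>ln pi\<bar> / 2)"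
        using 1 2 unfolding log_sine_sum_error_eq[OF elim(2)] by linarith
    qed
  qed
qed

section \<open>The shift by a and Euler's product\<close>

text \<open>
  The quotient of \<open>\<Prod>l=1..k. sin ((l + a) * h) * sin ((l - a) * h)\<close> by its value at \<open>a = 0\<close>.
  As \<open>h \<rightarrow> 0\<close> it turns into a partial product of Euler's product for the sine.
\<close>
definition shift_correction :: "real \<Rightarrow> real \<Rightarrow> nat \<Rightarrow> real" where
  "shift_correction a h k = (\<Prod>l=1..k. 1 - (sin (a * h))\<^sup>2 / (sin (real l * h))\<^sup>2)"

lemma shift_ratio_bound:
  assumes h: "h > 0" and l: "l \<ge> 1" "(real l + 1) * h \<le> pi"
  shows "(sin (a * h))\<^sup>2 / (sin (real l * h))\<^sup>2 \<le> a\<^sup>2 * pi\<^sup>2 * edge_bound h l"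
proof -
  have "\<bar>sin (a * h)\<bar> \<le> \<bar>a * h\<bar>" by (rule abs_sin_x_le_abs_x)
  then have "(sin (a * h))\<^sup>2 \<le> (a * h)\<^sup>2" by (simp add: abs_le_square_iff)
  moreover have "1 / (sin (real l * h))\<^sup>2 \<le> pi\<^sup>2 / h\<^sup>2 * edge_bound h l"
    using h l by (intro inverse_sin_square_edge_bound) (auto simp: algebra_simps)
  ultimately have "(sin (a * h))\<^sup>2 * (1 / (sin (real l * h))\<^sup>2) \<le> (a * h)\<^sup>2 * (pi\<^sup>2 / h\<^sup>2 * edge_bound h l)"
    by (intro mult_mono) auto
  also have "\<dots> = a\<^sup>2 * pi\<^sup>2 * edge_bound h l" using h by (simp add: power_mult_distrib)
  finally show ?thesis by simp
qed

lemma shift_correction_bounded: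
  assumes h: "h > 0" and k: "(real k + 1) * h \<le> pi"
  shows "\<bar>shift_correction a h k\<bar> \<le> exp (a\<^sup>2 * pi\<^sup>2 * (pi\<^sup>2 / 3))"
proof -
  let ?z = "\<lambda>l. (sin (a * h))\<^sup>2 / (sin (real l * h))\<^sup>2"
  have "\<bar>shift_correction a h k\<bar> = (\<Prod>l=1..k. \<bar>1 - ?z l\<bar>)"
    by (simp add: shift_correction_def abs_prod)
  also have "\<dots> \<le> (\<Prod>l=1..k. exp (?z l))"
  proof (rule prod_mono, intro conjI)
    fix l
    have "\<bar>1 - ?z l\<bar> \<le> 1 + ?z l" by (simp add: abs_le_iff)
    also have "\<dots> \<le> exp (?z l)" by (rule exp_ge_add_one_self)
    finally show "\<bar>1 - ?z l\<bar> \<le> exp (?z l)" .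
  qed auto
  also have "\<dots> = exp (\<Sum>l=1..k. ?z l)" by (simp add: exp_sum)
  also have "(\<Sum>l=1..k. ?z l) \<le> (\<Sum>l=1..k. a\<^sup>2 * pi\<^sup>2 * edge_bound h l)"
  proof (rule sum_mono, rule shift_ratio_bound)
    fix l assume "l \<in> {1..k}"
    then have "(real l + 1) * h \<le> (real k + 1) * h" using h by (intro mult_right_mono) auto
    with k show "(real l + 1) * h \<le> pi" by (meson order_trans)
  qed (use h in auto)
  also have "\<dots> \<le> a\<^sup>2 * pi\<^sup>2 * (pi\<^sup>2 / 3)"
    unfolding sum_distrib_left[symmetric] using h k
    by (intro mult_left_mono sum_edge_bound_le) (auto simp: add_ac)
  finally show ?thesis by simp
qed

lemma sin_scaled_at_0:
  fixes c :: real
  shows "((\<lambda>h. sin (c * h) / h) \<longlongrightarrow> c) (at_right 0)"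
proof -
  have "((\<lambda>h. sin (c * h)) has_real_derivative c) (at 0)"
    by (auto intro!: derivative_eq_intros)
  then have "((\<lambda>h. sin (c * h) / h) \<longlongrightarrow> c) (at 0)"
    by (simp add: DERIV_def)
  then show ?thesis by (rule tendsto_mono[OF at_le, rotated]) auto
qed

lemma shift_ratio_tendsto:
  assumes "l \<ge> 1"
  shows "((\<lambda>h. (sin (a * h))\<^sup>2 / (sin (real l * h))\<^sup>2) \<longlongrightarrow> a\<^sup>2 / (real l)\<^sup>2) (at_right 0)"
proof -
  have "((\<lambda>h. (sin (a * h) / h)\<^sup>2 / (sin (real l * h) / h)\<^sup>2) \<longlongrightarrow> a\<^sup>2 / (real l)\<^sup>2) (at_right 0)"
    using assms by (intro tendsto_intros sin_scaled_at_0) auto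
  moreover have "eventually (\<lambda>h. (sin (a * h) / h)\<^sup>2 / (sin (real l * h) / h)\<^sup>2 =
      (sin (a * h))\<^sup>2 / (sin (real l * h))\<^sup>2) (at_right 0)"
    using eventually_at_right_less[of 0] by eventually_elim (auto simp: power_divide)
  ultimately show ?thesis by (rule Lim_transform_eventually)
qed

text \<open>
  This turns a product with a growing number of factors, some of which may be negative, into a sum
  to which Tannery's theorem applies.
\<close>
lemma telescope_prod_one_minus:
  fixes z :: "nat \<Rightarrow> 'a::comm_ring_1"
  shows "(\<Sum>l=1..m. - z l * (\<Prod>j=1..l-1. 1 - z j)) = (\<Prod>l=1..m. 1 - z l) - 1"
  by (induction m) (simp_all add: algebra_simps)

text \<open>
  The summands of the telescoped product are dominated by \<open>edge_bound\<close>, since the partial products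
  are bounded; the limiting sum is Euler's product for the sine, telescoped in the same way.
\<close>
lemma (in interior_sequence) shift_correction_tendsto:
  "(\<lambda>n. shift_correction a (h n) (k n)) \<longlonglongrightarrow> sin_pi_quotient a"
proof (cases "a = 0")
  case True
  then show ?thesis by (simp add: shift_correction_def sin_pi_quotient_def)
next
  case False
  define f where "f = (\<lambda>h l. - ((sin (a * h))\<^sup>2 / (sin (real l * h))\<^sup>2) * shift_correction a h (l - 1))"
  define g where "g = (\<lambda>l. - (a\<^sup>2 / (real l)\<^sup>2) * (\<Prod>j=1..l-1. 1 - a\<^sup>2 / (real j)\<^sup>2))"
  have g: "(\<Sum>l=1..m. g l) = (\<Prod>l=1..m. 1 - a\<^sup>2 / (real l)\<^sup>2) - 1" for m
    unfolding g_def by (rule telescope_prod_one_minus)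
  have f: "(\<Sum>l=1..m. f h l) = shift_correction a h m - 1" for m h
    unfolding f_def shift_correction_def by (rule telescope_prod_one_minus)
  obtain S where S: "(\<lambda>m. \<Sum>l=1..m. g l) \<longlonglongrightarrow> S" "(\<lambda>n. \<Sum>l=1..k n. f (h n) l) \<longlonglongrightarrow> S"
  proof (rule tannery_edge_bound[of f g "a\<^sup>2 * pi\<^sup>2 * exp (a\<^sup>2 * pi\<^sup>2 * (pi\<^sup>2 / 3))"])
    fix l :: nat assume l: "l \<ge> 1"
    show "((\<lambda>h. f h l) \<longlongrightarrow> g l) (at_right 0)"
      unfolding f_def g_def shift_correction_def
      using l by (intro tendsto_intros shift_ratio_tendsto) auto
    fix h :: real assume h: "h > 0" "(real l + 1) * h \<le> pi"
    have "(real (l - 1) + 1) * h \<le> (real l + 1) * h" using h by (intro mult_right_mono) auto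
    with h have "(real (l - 1) + 1) * h \<le> pi" by (meson order_trans)
    then have "((sin (a * h))\<^sup>2 / (sin (real l * h))\<^sup>2) * \<bar>shift_correction a h (l - 1)\<bar> \<le>
        (a\<^sup>2 * pi\<^sup>2 * edge_bound h l) * exp (a\<^sup>2 * pi\<^sup>2 * (pi\<^sup>2 / 3))"
      using h l by (intro mult_mono shift_ratio_bound shift_correction_bounded) (auto simp: edge_bound_def)
    then show "\<bar>f h l\<bar> \<le> a\<^sup>2 * pi\<^sup>2 * exp (a\<^sup>2 * pi\<^sup>2 * (pi\<^sup>2 / 3)) * edge_bound h l"
      by (simp add: f_def abs_mult mult_ac)
  qed auto
  have "(\<lambda>m. \<Sum>l=1..m. g l) \<longlonglongrightarrow> sin_pi_quotient a - 1"
    unfolding g using False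
    by (intro tendsto_intros) (use sin_product_formula_real'[OF False] in \<open>simp add: sin_pi_quotient_def mult.commute\<close>)
  with S(1) have "S = sin_pi_quotient a - 1" by (rule LIMSEQ_unique)
  with tendsto_add[OF S(2)[unfolded f] tendsto_const[of 1]] show ?thesis by simp
qed

section \<open>The peak of the log-sine integral\<close>

lemma sin_cos_5_pi_6: "sin (5 * pi / 6) = 1 / 2" "cos (5 * pi / 6) = - sqrt 3 / 2"
proof -
  have e: "5 * pi / 6 = pi - pi / 6" by (simp add: field_simps)
  show "sin (5 * pi / 6) = 1 / 2" "cos (5 * pi / 6) = - sqrt 3 / 2"
    unfolding e sin_pi_minus cos_pi_minus by (simp_all add: sin_30 cos_30)
qed

text \<open>
  At \<open>5 * pi / 6\<close> the first derivative \<open>ln (2 * sin \<theta>)\<close> is \<open>0\<close> and the second, \<open>cot \<theta>\<close>, is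
  \<open>- sqrt 3\<close>.  The constant \<open>12\<close> is one sixth of a bound for the third derivative on the interval
  of radius \<open>pi / 12\<close>.
\<close>
lemma log_sine_integral_near_peak:
  assumes u: "\<bar>u\<bar> \<le> pi / 12"
  shows "\<bar>log_sine_integral (5 * pi / 6 + u) - log_sine_integral (5 * pi / 6) + sqrt 3 / 2 * u\<^sup>2\<bar> \<le> 12 * \<bar>u\<bar> ^ 3"
proof (cases "u = 0")
  case False
  let ?c = "5 * pi / 6"
  have ub: "- (pi / 12) \<le> u" "u \<le> pi / 12" using u by auto
  have c: "0 < ?c" "?c < pi" "0 < ?c + u" "?c + u < pi" "?c + u \<noteq> ?c"
    using ub False pi_gt3 by auto
  obtain t where t: "min ?c (?c + u) < t" "t < max ?c (?c + u)"
    "log_sine_integral (?c + u) = log_sine_integral ?c + ln (2 * sin ?c) * (?c + u - ?c)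
       + cot ?c / 2 * (?c + u - ?c)\<^sup>2 - (?c + u - ?c) ^ 3 / (6 * (sin t)\<^sup>2)"
    by (rule log_sine_integral_taylor[OF c])
  have tb: "pi / 12 \<le> t" "pi / 12 \<le> pi - t"
    using t(1,2) ub pi_gt3 by (auto simp: min_def max_def split: if_splits)
  have "1 / (sin t)\<^sup>2 \<le> (pi\<^sup>2 / 4) * (1 / t\<^sup>2 + 1 / (pi - t)\<^sup>2)"
    using tb pi_gt3 by (intro inverse_sin_square_bound) auto
  also have "\<dots> \<le> (pi\<^sup>2 / 4) * (1 / (pi / 12)\<^sup>2 + 1 / (pi / 12)\<^sup>2)"
    using tb pi_gt3
    by (intro mult_left_mono add_mono divide_left_mono power_mono mult_pos_pos zero_less_power) auto
  also have "\<dots> = 72" by (simp add: power_divide)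
  finally have s: "1 / (sin t)\<^sup>2 \<le> 72" .
  have "log_sine_integral (?c + u) - log_sine_integral ?c + sqrt 3 / 2 * u\<^sup>2 = - (u ^ 3 / 6 * (1 / (sin t)\<^sup>2))"
    unfolding t(3) by (simp add: sin_cos_5_pi_6 cot_def)
  then have "\<bar>log_sine_integral (?c + u) - log_sine_integral ?c + sqrt 3 / 2 * u\<^sup>2\<bar> = \<bar>u\<bar> ^ 3 / 6 * (1 / (sin t)\<^sup>2)"
    by (simp add: abs_mult power_abs)
  also have "\<dots> \<le> \<bar>u\<bar> ^ 3 / 6 * 72" using s by (intro mult_left_mono) auto
  finally show ?thesis by simp
qed auto

text \<open>
  The function decreases on the interval from \<open>0\<close> to \<open>pi / 6\<close>, increases on the one from \<open>pi / 6\<close> to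
  \<open>pi / 2\<close>, and vanishes at both outer ends.
\<close>
lemma log_sine_integral_nonpos:
  assumes "0 < \<theta>" "\<theta> \<le> pi / 2"
  shows "log_sine_integral \<theta> \<le> 0"
proof (cases "\<theta> \<ge> pi / 6")
  case True
  have "log_sine_integral \<theta> \<le> log_sine_integral (pi / 2)"
  proof (rule DERIV_nonneg_imp_nondecreasing[where f = log_sine_integral])
    fix x assume x: "\<theta> \<le> x" "x \<le> pi / 2"
    have "sin (pi / 6) \<le> sin x" using x True by (intro sin_monotone_2pi_le) auto
    then have "0 \<le> ln (2 * sin x)" by (simp add: sin_30)
    then show "\<exists>y. (log_sine_integral has_real_derivative y) (at x) \<and> 0 \<le> y"
      using log_sine_integral_derivative[of x] x assms pi_gt3 by force
  qed (use assms in auto)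
  then show ?thesis by simp
next
  case False
  show ?thesis
  proof (rule tendsto_lowerbound[OF log_sine_integral_at_right_0])
    show "eventually (\<lambda>x. log_sine_integral \<theta> \<le> log_sine_integral x) (at_right 0)"
      unfolding eventually_at_right_field
    proof (intro exI[of _ \<theta>] conjI allI impI)
      fix y assume y: "0 < y" "y < \<theta>"
      show "log_sine_integral \<theta> \<le> log_sine_integral y"
      proof (rule DERIV_nonpos_imp_nonincreasing[where f = log_sine_integral])
        fix x assume x: "y \<le> x" "x \<le> \<theta>"
        have "sin x \<le> sin (pi / 6)" using x y False by (intro sin_monotone_2pi_le) auto
        moreover have "sin x > 0" using x y False assms by (intro sin_gt_zero) auto
        ultimately have "ln (2 * sin x) \<le> 0" by (simp add: sin_30)
        moreover have "0 < x" "x < pi" using x y assms by auto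
        ultimately show "\<exists>z. (log_sine_integral has_real_derivative z) (at x) \<and> z \<le> 0"
          using log_sine_integral_derivative[of x] by blast
      qed (use y in auto)
    qed (use assms in auto)
  qed auto
qed

lemma two_sin_ge_chord:
  assumes "pi / 2 \<le> x" "x \<le> 5 * pi / 6"
  shows "2 * sin x \<ge> 1 + 3 / pi * (5 * pi / 6 - x)"
proof -
  have "concave_on {0..pi} sin"
  proof (rule f''_le0_imp_concave)
    show "\<And>x. (cos has_real_derivative - sin x) (at x)" by (rule DERIV_cos)
    show "\<And>x. x \<in> {0..pi} \<Longrightarrow> - sin x \<le> 0" by (auto intro!: sin_ge_zero)
  qed (auto intro!: derivative_eq_intros)
  moreover define t where "t = 3 * x / pi - 3 / 2"
  moreover have "0 \<le> t" "t \<le> 1" using assms by (auto simp: t_def field_simps)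
  ultimately have "sin ((1 - t) *\<^sub>R (pi / 2) + t *\<^sub>R (5 * pi / 6))
      \<ge> (1 - t) * sin (pi / 2) + t * sin (5 * pi / 6)"
    by (intro concave_onD) auto
  moreover have "(1 - t) *\<^sub>R (pi / 2) + t *\<^sub>R (5 * pi / 6) = x" by (simp add: t_def field_simps)
  moreover have "3 / pi * (5 * pi / 6 - x) = 1 - t" by (simp add: t_def field_simps)
  ultimately show ?thesis by (simp add: sin_cos_5_pi_6)
qed

lemma two_sin_le_tangent:
  assumes "5 * pi / 6 \<le> x" "x \<le> pi"
  shows "2 * sin x \<le> 1 - sqrt 3 * (x - 5 * pi / 6)"
proof -
  have "2 * sin x + sqrt 3 * (x - 5 * pi / 6) \<le> 2 * sin (5 * pi / 6) + sqrt 3 * (5 * pi / 6 - 5 * pi / 6)"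
  proof (rule DERIV_nonpos_imp_nonincreasing[where f = "\<lambda>a. 2 * sin a + sqrt 3 * (a - 5 * pi / 6)"])
    fix y assume y: "5 * pi / 6 \<le> y" "y \<le> x"
    have "cos y \<le> cos (5 * pi / 6)" using y assms by (intro cos_monotone_0_pi_le) auto
    then have "2 * cos y + sqrt 3 \<le> 0" by (simp add: sin_cos_5_pi_6)
    moreover have "((\<lambda>a. 2 * sin a + sqrt 3 * (a - 5 * pi / 6)) has_real_derivative 2 * cos y + sqrt 3) (at y)"
      by (auto intro!: derivative_eq_intros)
    ultimately show "\<exists>z. ((\<lambda>a. 2 * sin a + sqrt 3 * (a - 5 * pi / 6)) has_real_derivative z) (at y) \<and> z \<le> 0"
      by blast
  qed (use assms in auto)
  then show ?thesis by (simp add: sin_cos_5_pi_6)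
qed

text \<open>
  The derivative \<open>ln (2 * sin x)\<close> is compared with a linear function that has the same zero
  \<open>5 * pi / 6\<close>: to the left of it the chord of the concave function \<open>sin\<close> gives a lower bound, to
  the right the tangent gives an upper bound.
\<close>
lemma log_sine_integral_right_bound:
  assumes "pi / 2 \<le> \<theta>" "\<theta> < pi"
  shows "log_sine_integral \<theta> + 3 / (4 * pi) * (\<theta> - 5 * pi / 6)\<^sup>2 \<le> log_sine_integral (5 * pi / 6)"
proof -
  define G where "G = (\<lambda>\<theta>. log_sine_integral \<theta> + 3 / (4 * pi) * (\<theta> - 5 * pi / 6)\<^sup>2)"
  have G: "(G has_real_derivative ln (2 * sin x) + 3 / (2 * pi) * (x - 5 * pi / 6)) (at x)"
    if "0 < x" "x < pi" for x
    unfolding G_def using that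
    by (auto intro!: derivative_eq_intros log_sine_integral_derivative simp: field_simps)
  have "G \<theta> \<le> G (5 * pi / 6)"
  proof (cases "\<theta> \<le> 5 * pi / 6")
    case True
    then show ?thesis
    proof (rule DERIV_nonneg_imp_nondecreasing)
      fix x assume x: "\<theta> \<le> x" "x \<le> 5 * pi / 6"
      define z where "z = 3 / pi * (5 * pi / 6 - x)"
      have z: "0 \<le> z" "z \<le> 1" using x assms by (auto simp: z_def field_simps)
      \<comment> \<open>\<open>ln (1 + z) \<ge> z / 2\<close> for \<open>z\<close> in the unit interval\<close>
      have "z / 2 \<le> z / (1 + z)" using z by (intro divide_left_mono) auto
      also have "\<dots> \<le> ln (1 + z)" 
      proof -
        have "ln (inverse (1 + z)) \<le> inverse (1 + z) - 1" using z by (intro ln_le_minus_one) auto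
        moreover have "inverse (1 + z) - 1 = - (z / (1 + z))" using z by (simp add: field_simps)
        ultimately show ?thesis using z by (simp add: ln_inverse)
      qed
      also have "\<dots> \<le> ln (2 * sin x)"
      proof -
        have "1 + z \<le> 2 * sin x" unfolding z_def using x assms by (intro two_sin_ge_chord) auto
        then show ?thesis using z by (subst ln_le_cancel_iff) auto
      qed
      also have "z / 2 = - (3 / (2 * pi) * (x - 5 * pi / 6))" by (simp add: z_def field_simps)
      finally have "0 \<le> ln (2 * sin x) + 3 / (2 * pi) * (x - 5 * pi / 6)" by linarith
      moreover have "0 < x" "x < pi" using x assms pi_gt3 by auto
      ultimately show "\<exists>y. (G has_real_derivative y) (at x) \<and> 0 \<le> y" using G by blast
    qed
  next
    case False
    then have "5 * pi / 6 \<le> \<theta>" by simp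
    then show ?thesis
    proof (rule DERIV_nonpos_imp_nonincreasing)
      fix x assume x: "5 * pi / 6 \<le> x" "x \<le> \<theta>"
      have xp: "0 < x" "x < pi" using x assms pi_gt3 by auto
      have "ln (2 * sin x) \<le> 2 * sin x - 1" using xp sin_gt_zero[of x] by (intro ln_le_minus_one) auto
      also have "\<dots> \<le> - (sqrt 3 * (x - 5 * pi / 6))" using two_sin_le_tangent[of x] x xp by simp
      also have "\<dots> \<le> - (3 / (2 * pi) * (x - 5 * pi / 6))"
      proof -
        have "3 / (2 * pi) \<le> 1" using pi_gt3 by simp
        also have "1 \<le> sqrt 3" by simp
        finally show ?thesis using x by (intro le_imp_neg_le mult_right_mono) auto
      qed
      finally have "ln (2 * sin x) + 3 / (2 * pi) * (x - 5 * pi / 6) \<le> 0" by linarith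
      then show "\<exists>y. (G has_real_derivative y) (at x) \<and> y \<le> 0" using G xp by blast
    qed
  qed
  then show ?thesis by (simp add: G_def)
qed

text \<open>
  For \<open>\<theta> \<le> pi / 2\<close> the value is nonpositive, while the previous bound at \<open>pi / 2\<close> makes the peak
  value at least \<open>3 / (4 * pi) * (pi / 3)\<^sup>2\<close>.  The constant is chosen so that
  \<open>3 / (25 * pi) * (5 * pi / 6)\<^sup>2\<close> equals this number.
\<close>
lemma log_sine_integral_peak_bound:
  assumes "0 < \<theta>" "\<theta> < pi"
  shows "log_sine_integral \<theta> \<le> log_sine_integral (5 * pi / 6) - 3 / (25 * pi) * (\<theta> - 5 * pi / 6)\<^sup>2"
proof (cases "\<theta> \<le> pi / 2")
  case True
  have "log_sine_integral (pi / 2) + 3 / (4 * pi) * (pi / 2 - 5 * pi / 6)\<^sup>2 \<le> log_sine_integral (5 * pi / 6)"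
    by (rule log_sine_integral_right_bound) (use pi_gt3 in auto)
  moreover have "3 / (4 * pi) * (pi / 2 - 5 * pi / 6)\<^sup>2 = 3 / (25 * pi) * (5 * pi / 6)\<^sup>2"
    by (simp add: field_simps power2_eq_square)
  moreover have "3 / (25 * pi) * (\<theta> - 5 * pi / 6)\<^sup>2 \<le> 3 / (25 * pi) * (5 * pi / 6)\<^sup>2"
  proof (rule mult_left_mono)
    have "\<bar>\<theta> - 5 * pi / 6\<bar> \<le> \<bar>5 * pi / 6\<bar>"
      unfolding abs_le_iff using assms True by auto
    then show "(\<theta> - 5 * pi / 6)\<^sup>2 \<le> (5 * pi / 6)\<^sup>2" by (simp only: abs_le_square_iff)
  qed simp
  ultimately show ?thesis using log_sine_integral_nonpos[OF assms(1) True] by simp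
next
  case False
  have "3 / (25 * pi) * (\<theta> - 5 * pi / 6)\<^sup>2 \<le> 3 / (4 * pi) * (\<theta> - 5 * pi / 6)\<^sup>2"
    by (intro mult_right_mono) (auto simp: field_simps)
  then show ?thesis using log_sine_integral_right_bound[of \<theta>] False assms by simp
qed

section \<open>The Jones polynomial as a real sum\<close>

lemma exp_imaginary_diff:
  "exp (complex_of_real x * (2 * complex_of_real pi * \<i> / complex_of_real N))
     - exp (complex_of_real (- x) * (2 * complex_of_real pi * \<i> / complex_of_real N))
   = 2 * \<i> * complex_of_real (sin (2 * x * (pi / N)))"
proof -
  have e: "exp (complex_of_real y * (2 * complex_of_real pi * \<i> / complex_of_real N)) = cis (2 * y * (pi / N))" for y
    by (simp add: cis_conv_exp mult_ac)
  show ?thesis unfolding e by (simp add: complex_eq_iff)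
qed

text \<open>
  The summand of the Jones polynomial at \<open>h = pi / (M + a)\<close>: the supplementary angles
  \<open>(M - l) * h = pi - (l + a) * h\<close> and \<open>(M + l) * h = pi + (l - a) * h\<close> remove \<open>M\<close> from the product.
\<close>
definition jones_term :: "real \<Rightarrow> real \<Rightarrow> nat \<Rightarrow> real" where
  "jones_term a h k = (\<Prod>l=1..k. 4 * sin ((real l + a) * h) * sin ((real l - a) * h))"

lemma colored_jones_fig8_eq_sum:
  assumes M: "M > 0" and a: "a \<ge> 0"
  shows "colored_jones_fig8 M (2 * complex_of_real pi * \<i> / complex_of_real (real M + a))
    = complex_of_real (\<Sum>k<M. jones_term a (pi / (real M + a)) k)"
proof -
  define N where "N = real M + a"
  define h where "h = pi / N"
  define \<eta> where "\<eta> = 2 * complex_of_real pi * \<i> / complex_of_real N"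
  have N: "N > 0" using assms by (simp add: N_def)
  then have Mh: "real M * h = pi - a * h" by (simp add: h_def N_def field_simps)
  have factor: "(exp (complex_of_real ((real M - real l) / 2) * \<eta>) - exp (complex_of_real (- ((real M - real l) / 2)) * \<eta>)) *
      (exp (complex_of_real ((real M + real l) / 2) * \<eta>) - exp (complex_of_real (- ((real M + real l) / 2)) * \<eta>))
      = complex_of_real (4 * sin ((real l + a) * h) * sin ((real l - a) * h))" for l
  proof -
    have "2 * ((real M - real l) / 2) * (pi / N) = real M * h - real l * h"
      using N by (simp add: h_def field_simps)
    also have "\<dots> = pi - (real l + a) * h" unfolding Mh by (simp add: algebra_simps)
    finally have 1: "sin (2 * ((real M - real l) / 2) * (pi / N)) = sin ((real l + a) * h)" by simp
    have "2 * ((real M + real l) / 2) * (pi / N) = real M * h + real l * h"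
      using N by (simp add: h_def field_simps)
    also have "\<dots> = (real l - a) * h + pi" unfolding Mh by (simp add: algebra_simps)
    finally have 2: "sin (2 * ((real M + real l) / 2) * (pi / N)) = - sin ((real l - a) * h)" by simp
    show ?thesis unfolding \<eta>_def exp_imaginary_diff 1 2 by (simp add: mult_ac)
  qed
  have "colored_jones_fig8 M \<eta> = 1 + (\<Sum>k=1..M-1. complex_of_real (jones_term a h k))"
    unfolding colored_jones_fig8_def Let_def factor by (simp add: jones_term_def)
  also have "\<dots> = (\<Sum>k<M. complex_of_real (jones_term a h k))"
  proof -
    have "{..<M} = insert 0 {1..M-1}" using M by auto
    then show ?thesis by (simp add: jones_term_def)
  qed
  finally show ?thesis by (simp add: \<eta>_def N_def h_def)
qed

lemma sin_sum_times_sin_diff: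
  fixes x y :: real
  shows "sin (x + y) * sin (x - y) = (sin x)\<^sup>2 - (sin y)\<^sup>2"
proof -
  have "sin (x + y) * sin (x - y) = (sin x)\<^sup>2 * (cos y)\<^sup>2 - (cos x)\<^sup>2 * (sin y)\<^sup>2"
    by (simp add: sin_add sin_diff algebra_simps power2_eq_square)
  then show ?thesis by (simp add: cos_squared_eq algebra_simps)
qed

lemma jones_term_eq:
  assumes h: "h > 0" and k: "(real k + 1) * h \<le> pi"
  shows "jones_term a h k = pi / h * exp (2 * log_sine_sum_error h k)
     * exp (2 * log_sine_integral ((k + 1/2) * h) / h) * shift_correction a h k"
proof -
  have s: "sin (real l * h) > 0" if "l \<in> {1..k}" for l
  proof (rule sin_gt_zero)
    have "real l * h < (real k + 1) * h" using that h by (intro mult_strict_right_mono) auto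
    with k show "real l * h < pi" by linarith
  qed (use that h in auto)
  have "jones_term a h k = (\<Prod>l=1..k. (2 * sin (real l * h))\<^sup>2 * (1 - (sin (a * h))\<^sup>2 / (sin (real l * h))\<^sup>2))"
    unfolding jones_term_def
  proof (rule prod.cong)
    fix l assume l: "l \<in> {1..k}"
    have "sin ((real l + a) * h) * sin ((real l - a) * h) = (sin (real l * h))\<^sup>2 - (sin (a * h))\<^sup>2"
      using sin_sum_times_sin_diff[of "real l * h" "a * h"] by (simp add: distrib_right left_diff_distrib)
    then show "4 * sin ((real l + a) * h) * sin ((real l - a) * h) =
      (2 * sin (real l * h))\<^sup>2 * (1 - (sin (a * h))\<^sup>2 / (sin (real l * h))\<^sup>2)"
      using s[OF l] by (simp add: power_mult_distrib right_diff_distrib)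
  qed simp
  also have "\<dots> = (\<Prod>l=1..k. (2 * sin (real l * h))\<^sup>2) * shift_correction a h k"
    by (simp add: shift_correction_def prod.distrib)
  also have "(\<Prod>l=1..k. (2 * sin (real l * h))\<^sup>2) = (\<Prod>l=1..k. exp (2 * ln (2 * sin (real l * h))))"
  proof (rule prod.cong)
    fix l assume l: "l \<in> {1..k}"
    have "exp (2 * ln (2 * sin (real l * h))) = (exp (ln (2 * sin (real l * h))))\<^sup>2"
      by (simp add: exp_double)
    then show "(2 * sin (real l * h))\<^sup>2 = exp (2 * ln (2 * sin (real l * h)))" using s[OF l] by simp
  qed simp
  also have "\<dots> = exp (2 * (\<Sum>l=1..k. ln (2 * sin (real l * h))))"
    by (simp add: exp_sum sum_distrib_left)
  also have "2 * (\<Sum>l=1..k. ln (2 * sin (real l * h))) =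
     ln (pi / h) + 2 * log_sine_sum_error h k + 2 * log_sine_integral ((k + 1/2) * h) / h"
    by (simp add: log_sine_sum_error_def)
  also have "exp \<dots> = pi / h * exp (2 * log_sine_sum_error h k) * exp (2 * log_sine_integral ((k + 1/2) * h) / h)"
    using h by (simp only: exp_add) simp
  finally show ?thesis .
qed

section \<open>Lattice sums with a Gaussian limit\<close>

lemma gaussian_integral:
  fixes c :: real
  assumes "c > 0"
  shows "integrable lborel (\<lambda>y. exp (- c * y\<^sup>2))" "(\<integral>y. exp (- c * y\<^sup>2) \<partial>lborel) = sqrt (pi / c)"
proof -
  define \<sigma> where "\<sigma> = sqrt (1 / (2 * c))"
  have \<sigma>: "\<sigma> > 0" "\<sigma>\<^sup>2 = 1 / (2 * c)" using assms by (auto simp: \<sigma>_def)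
  have e: "exp (- c * y\<^sup>2) = sqrt (pi / c) * normal_density 0 \<sigma> y" for y
    using assms by (simp add: normal_density_def \<sigma>(2) mult_ac)
  show "integrable lborel (\<lambda>y. exp (- c * y\<^sup>2))" "(\<integral>y. exp (- c * y\<^sup>2) \<partial>lborel) = sqrt (pi / c)"
    unfolding e using \<sigma>(1) by (simp_all)
qed

text \<open>
  The sum is the integral of a step function in \<open>y\<close> with steps of width \<open>1 / s n\<close>, to which dominated
  convergence applies.  The rate of the dominating Gaussian is halved because \<open>y\<close> may differ from
  the midpoint of its step by at most \<open>1/2\<close>.
\<close>
lemma lattice_sum_tendsto_integral:
  fixes u :: "nat \<Rightarrow> nat \<Rightarrow> real" and c s :: "nat \<Rightarrow> real" and G :: "real \<Rightarrow> real"
  assumes s: "eventually (\<lambda>n. s n \<ge> 1) sequentially"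
    and b: "b > 0"
    and dom: "eventually (\<lambda>n. \<forall>k<m n. \<bar>u n k\<bar> \<le> C * exp (- b * ((k + 1/2 - c n) / s n)\<^sup>2)) sequentially"
    and range: "\<And>y. eventually (\<lambda>n. 0 \<le> c n + s n * y \<and> nat \<lfloor>c n + s n * y\<rfloor> < m n) sequentially"
    and lim: "\<And>y. (\<lambda>n. u n (nat \<lfloor>c n + s n * y\<rfloor>)) \<longlonglongrightarrow> G y"
    and C: "C \<ge> 0" and G[measurable]: "G \<in> borel_measurable borel"
  shows "(\<lambda>n. (\<Sum>k<m n. u n k) / s n) \<longlonglongrightarrow> (\<integral>y. G y \<partial>lborel)"
proof -
  define J where "J = (\<lambda>n k. {(real k - c n) / s n ..< (real (Suc k) - c n) / s n})"
  define F where "F = (\<lambda>n y. \<Sum>k<m n. u n k * indicator (J n k) y)"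
  have mem: "y \<in> J n k \<longleftrightarrow> 0 \<le> c n + s n * y \<and> k = nat \<lfloor>c n + s n * y\<rfloor>" if "s n \<ge> 1" for n k y
  proof -
    have "y \<in> J n k \<longleftrightarrow> real k \<le> c n + s n * y \<and> c n + s n * y < real k + 1"
      using that by (auto simp: J_def field_simps)
    also have "\<dots> \<longleftrightarrow> \<lfloor>c n + s n * y\<rfloor> = int k"
      by (auto simp: floor_eq_iff)
    also have "\<dots> \<longleftrightarrow> 0 \<le> c n + s n * y \<and> k = nat \<lfloor>c n + s n * y\<rfloor>"
      by (auto simp: nat_eq_iff2 simp flip: zero_le_floor)
    finally show ?thesis .
  qed
  have F_eq: "F n y = (if 0 \<le> c n + s n * y \<and> nat \<lfloor>c n + s n * y\<rfloor> < m n then u n (nat \<lfloor>c n + s n * y\<rfloor>) else 0)"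
    if "s n \<ge> 1" for n y
  proof -
    have "F n y = (\<Sum>k<m n. if k = nat \<lfloor>c n + s n * y\<rfloor> then (if 0 \<le> c n + s n * y then u n k else 0) else 0)"
      unfolding F_def by (intro sum.cong refl) (auto simp: indicator_def mem[OF that])
    then show ?thesis by (simp add: sum.delta)
  qed
  have "eventually (\<lambda>n. s n \<ge> 1 \<and> (\<forall>k<m n. \<bar>u n k\<bar> \<le> C * exp (- b * ((k + 1/2 - c n) / s n)\<^sup>2))) sequentially"
    using s dom by eventually_elim auto
  then obtain n0 where n0: "\<And>n. n \<ge> n0 \<Longrightarrow> s n \<ge> 1"
    "\<And>n k. n \<ge> n0 \<Longrightarrow> k < m n \<Longrightarrow> \<bar>u n k\<bar> \<le> C * exp (- b * ((k + 1/2 - c n) / s n)\<^sup>2)"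
    unfolding eventually_sequentially by blast
  have "(\<lambda>n. \<integral>y. F (n + n0) y \<partial>lborel) \<longlonglongrightarrow> (\<integral>y. G y \<partial>lborel)"
  proof (rule integral_dominated_convergence)
    show "integrable lborel (\<lambda>y. C * exp (b / 4) * exp (- (b / 2) * y\<^sup>2))"
      using gaussian_integral(1)[of "b / 2"] b by (intro integrable_mult_right) auto
    show "(\<lambda>y. F (n + n0) y) \<in> borel_measurable lborel" for n
      unfolding F_def J_def by measurable
    show "AE y in lborel. (\<lambda>n. F (n + n0) y) \<longlonglongrightarrow> G y"
    proof (intro AE_I2)
      fix y
      have "eventually (\<lambda>n. u n (nat \<lfloor>c n + s n * y\<rfloor>) = F n y) sequentially"
        using s range[of y] by eventually_elim (simp add: F_eq)
      with lim[of y] have "(\<lambda>n. F n y) \<longlonglongrightarrow> G y" by (rule Lim_transform_eventually)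
      then show "(\<lambda>n. F (n + n0) y) \<longlonglongrightarrow> G y" by (rule LIMSEQ_ignore_initial_segment)
    qed
    show "AE y in lborel. norm (F (n + n0) y) \<le> C * exp (b / 4) * exp (- (b / 2) * y\<^sup>2)" for n
    proof (intro AE_I2)
      fix y
      define n' where "n' = n + n0"
      define k where "k = nat \<lfloor>c n' + s n' * y\<rfloor>"
      have n': "n' \<ge> n0" by (simp add: n'_def)
      show "norm (F (n + n0) y) \<le> C * exp (b / 4) * exp (- (b / 2) * y\<^sup>2)"
      proof (cases "0 \<le> c n' + s n' * y \<and> k < m n'")
        case True
        have s1: "s n' \<ge> 1" using n0(1) n' by simp
        define z where "z = (k + 1/2 - c n') / s n'"
        have "y \<in> J n' k" using True by (simp add: mem[OF s1] k_def)
        then have "\<bar>y - z\<bar> \<le> 1 / (2 * s n')"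
          using s1 by (auto simp: J_def z_def field_simps abs_le_iff)
        also have "\<dots> \<le> 1 / 2" using s1 by (simp add: field_simps)
        finally have "\<bar>y - z\<bar> \<le> 1 / 2" .
        then have "\<bar>y - z\<bar>\<^sup>2 \<le> (1 / 2)\<^sup>2" by (intro power_mono) auto
        then have d: "(y - z)\<^sup>2 \<le> 1 / 4" by (simp add: power_divide)
        have "0 \<le> (y - 2 * z)\<^sup>2" by simp
        also have "(y - 2 * z)\<^sup>2 = 2 * z\<^sup>2 + 2 * (y - z)\<^sup>2 - y\<^sup>2"
          by (simp add: power2_eq_square algebra_simps)
        finally have "y\<^sup>2 / 2 - 1 / 4 \<le> z\<^sup>2" using d by linarith
        then have "b * (y\<^sup>2 / 2 - 1 / 4) \<le> b * z\<^sup>2" using b by (intro mult_left_mono) auto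
        then have e: "- b * z\<^sup>2 \<le> b / 4 + - (b / 2) * y\<^sup>2" by (simp add: algebra_simps)
        have "norm (F n' y) = \<bar>u n' k\<bar>" using True s1 by (simp add: F_eq k_def)
        also have "\<dots> \<le> C * exp (- b * z\<^sup>2)" using n0(2)[OF n'] True by (simp add: z_def)
        also have "\<dots> \<le> C * exp (b / 4 + - (b / 2) * y\<^sup>2)" using C e by (intro mult_left_mono) auto
        finally show ?thesis by (simp only: exp_add n'_def mult.assoc)
      next
        case False
        then show ?thesis using C n0(1)[OF n'] F_eq[of n' y] by (auto simp: k_def n'_def)
      qed
    qed
  qed (use G in auto)
  then have "(\<lambda>n. \<integral>y. F n y \<partial>lborel) \<longlonglongrightarrow> (\<integral>y. G y \<partial>lborel)" by (rule LIMSEQ_offset)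
  moreover have "eventually (\<lambda>n. (\<integral>y. F n y \<partial>lborel) = (\<Sum>k<m n. u n k) / s n) sequentially"
    using s
  proof eventually_elim
    case (elim n)
    have meas: "measure lborel (J n k) = 1 / s n" "integrable lborel (indicat_real (J n k))" for k
    proof -
      have "(real k - c n) / s n \<le> (real (Suc k) - c n) / s n" using elim by (intro divide_right_mono) auto
      then show "measure lborel (J n k) = 1 / s n" "integrable lborel (indicat_real (J n k))"
        by (auto simp: J_def diff_divide_distrib add_divide_distrib)
    qed
    have "(\<integral>y. F n y \<partial>lborel) = (\<Sum>k<m n. \<integral>y. u n k * indicator (J n k) y \<partial>lborel)"
      unfolding F_def by (intro Bochner_Integration.integral_sum integrable_mult_right) (rule meas)
    also have "\<dots> = (\<Sum>k<m n. u n k * (1 / s n))"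
      by (intro sum.cong refl) (simp add: meas)
    finally show ?case by (simp add: sum_divide_distrib)
  qed
  ultimately show ?thesis by (rule Lim_transform_eventually)
qed

section \<open>Laplace's method\<close>

text \<open>
  For fixed \<open>y\<close>, the index \<open>k n\<close> lies \<open>y\<close> standard units \<open>sqrt N\<close> away from the peak \<open>5 * N / 6\<close>, up to
  rounding; \<open>z n\<close> is the rescaled offset of the midpoint \<open>k n + 1/2\<close>.
\<close>
locale near_peak =
  fixes a y :: real
  assumes a: "a \<ge> 0"
begin

definition N :: "nat \<Rightarrow> real" where "N n = real n + a"
definition k :: "nat \<Rightarrow> nat" where "k n = nat \<lfloor>5 * N n / 6 + sqrt (N n) * y\<rfloor>"
definition z :: "nat \<Rightarrow> real" where "z n = (real (k n) + 1/2 - 5 * N n / 6) / sqrt (N n)"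

lemma N_at_top: "filterlim N at_top sequentially"
proof (rule filterlim_at_top_mono[OF filterlim_real_sequentially])
  show "eventually (\<lambda>n. real n \<le> N n) sequentially" using a by (simp add: N_def)
qed

lemma sqrt_N_at_top: "filterlim (\<lambda>n. sqrt (N n)) at_top sequentially"
  by (rule filterlim_compose[OF sqrt_at_top N_at_top])

lemma eventually_large:
  "eventually (\<lambda>n. N n \<ge> 1 \<and> sqrt (N n) \<ge> 100 * (\<bar>y\<bar> + a + 1)) sequentially"
proof -
  have "eventually (\<lambda>n. N n \<ge> 1) sequentially" "eventually (\<lambda>n. sqrt (N n) \<ge> 100 * (\<bar>y\<bar> + a + 1)) sequentially"
    using N_at_top sqrt_N_at_top by (auto simp: filterlim_at_top)
  then show ?thesis by eventually_elim auto
qed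

lemma large_bounds:
  assumes "N n \<ge> 1 \<and> sqrt (N n) \<ge> 100 * (\<bar>y\<bar> + a + 1)"
  shows "N n / 2 \<le> 5 * N n / 6 + sqrt (N n) * y" "5 * N n / 6 + sqrt (N n) * y \<le> 9/10 * N n"
    "9/10 * N n + 1 \<le> n" 
proof -
  have sq: "sqrt (N n) * sqrt (N n) = N n" using assms by simp
  have "sqrt (N n) * (100 * (\<bar>y\<bar> + a + 1)) \<le> sqrt (N n) * sqrt (N n)"
    using assms by (intro mult_left_mono) auto
  then have b: "100 * (sqrt (N n) * \<bar>y\<bar>) + 100 * (sqrt (N n) * (a + 1)) \<le> N n"
    unfolding sq by (simp add: algebra_simps)
  have "sqrt (N n) * (a + 1) \<ge> 1 * (a + 1)" using assms a by (intro mult_right_mono) auto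
  then have a1: "a + 1 \<le> sqrt (N n) * (a + 1)" by simp
  have "\<bar>sqrt (N n) * y\<bar> = sqrt (N n) * \<bar>y\<bar>" using assms by (simp add: abs_mult)
  moreover have "100 * w + 100 * (a + 1) \<le> N n"
    if "100 * w + 100 * v \<le> N n" "a + 1 \<le> v" for v w
    using that by (simp add: distrib_left)
  ultimately have "100 * \<bar>sqrt (N n) * y\<bar> + 100 * (a + 1) \<le> N n" using b a1 by metis
  moreover have "\<bar>sqrt (N n) * y\<bar> \<ge> sqrt (N n) * y" "\<bar>sqrt (N n) * y\<bar> \<ge> - (sqrt (N n) * y)"
    by (rule abs_ge_self, rule abs_ge_minus_self)
  ultimately show "N n / 2 \<le> 5 * N n / 6 + sqrt (N n) * y"
      "5 * N n / 6 + sqrt (N n) * y \<le> 9/10 * N n" "9/10 * N n + 1 \<le> n"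
    using a by (simp_all add: N_def add_divide_distrib distrib_left)
qed

lemma k_bounds:
  assumes "N n \<ge> 1 \<and> sqrt (N n) \<ge> 100 * (\<bar>y\<bar> + a + 1)"
  shows "0 \<le> 5 * N n / 6 + sqrt (N n) * y" "real (k n) \<le> 5 * N n / 6 + sqrt (N n) * y"
    "5 * N n / 6 + sqrt (N n) * y < real (k n) + 1" "k n < n"
proof -
  show nn: "0 \<le> 5 * N n / 6 + sqrt (N n) * y" using large_bounds[OF assms] assms by linarith
  then show 1: "real (k n) \<le> 5 * N n / 6 + sqrt (N n) * y" "5 * N n / 6 + sqrt (N n) * y < real (k n) + 1"
    unfolding k_def by linarith+
  have "real (k n) < real n" using 1 large_bounds[OF assms] by linarith
  then show "k n < n" by simp
qed

sublocale interior_sequence "\<lambda>n. pi / N n" k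
proof
  have "filterlim (\<lambda>x. pi / x) (at_right 0) at_top" by real_asymp
  then show "filterlim (\<lambda>n. pi / N n) (at_right 0) sequentially"
    by (rule filterlim_compose[OF _ N_at_top])
  have "filterlim (\<lambda>x::real. x / 2 - 1) at_top at_top" by real_asymp
  then have "filterlim (\<lambda>n. N n / 2 - 1) at_top sequentially"
    by (rule filterlim_compose[OF _ N_at_top])
  then have "filterlim (\<lambda>n. real (k n)) at_top sequentially"
  proof (rule filterlim_at_top_mono)
    show "eventually (\<lambda>n. N n / 2 - 1 \<le> real (k n)) sequentially"
      using eventually_large
    proof eventually_elim
      case (elim n)
      show ?case using large_bounds(1)[OF elim] k_bounds(3)[OF elim] by linarith
    qed
  qed
  then show "filterlim k at_top sequentially" by (simp only: filterlim_sequentially_iff_filterlim_real)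
  show "eventually (\<lambda>n. real (k n) * (pi / N n) \<le> 9/10 * pi) sequentially"
    using eventually_large
  proof eventually_elim
    case (elim n)
    have "real (k n) \<le> 9/10 * N n" using large_bounds(2)[OF elim] k_bounds(2)[OF elim] by linarith
    then have "real (k n) * pi \<le> 9/10 * N n * pi" by (intro mult_right_mono) auto
    then show ?case using elim by (simp add: field_simps)
  qed
qed

lemma z_tendsto: "z \<longlonglongrightarrow> y"
proof -
  have inv: "(\<lambda>n. 1 / sqrt (N n)) \<longlonglongrightarrow> 0"
    using tendsto_divide_0[OF tendsto_const filterlim_at_top_imp_at_infinity[OF sqrt_N_at_top], of 1] by simp
  have bound: "eventually (\<lambda>n. norm (z n - y) \<le> 1 / sqrt (N n)) sequentially"
    using eventually_large
  proof eventually_elim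
    case (elim n)
    have s: "sqrt (N n) > 0" using elim by auto
    have "z n - y = (real (k n) + 1/2 - (5 * N n / 6 + sqrt (N n) * y)) / sqrt (N n)"
      using s by (simp add: z_def field_simps)
    moreover have "\<bar>real (k n) + 1/2 - (5 * N n / 6 + sqrt (N n) * y)\<bar> \<le> 1"
      using k_bounds[OF elim] by linarith
    ultimately show ?case using s by (simp add: divide_right_mono)
  qed
  from Lim_null_comparison[OF this inv] have "(\<lambda>n. z n - y) \<longlonglongrightarrow> 0" .
  then show ?thesis by (simp add: LIM_zero_iff)
qed

text \<open>
  With \<open>u = pi * z / sqrt N\<close> the quadratic Taylor term contributes
  \<open>- sqrt 3 / 2 * u\<^sup>2 * (2 * N / pi) = - sqrt 3 * pi * z\<^sup>2\<close>, and the cubic remainder is of order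
  \<open>1 / sqrt N\<close>.
\<close>
lemma peak_exponent_tendsto:
  "(\<lambda>n. 2 * (log_sine_integral ((real (k n) + 1/2) * (pi / N n)) - log_sine_integral (5 * pi / 6)) / (pi / N n))
     \<longlonglongrightarrow> - (sqrt 3 * pi) * y\<^sup>2"
proof -
  define u where "u = (\<lambda>n. pi * z n / sqrt (N n))"
  have inv: "(\<lambda>n. 1 / sqrt (N n)) \<longlonglongrightarrow> 0"
    using tendsto_divide_0[OF tendsto_const filterlim_at_top_imp_at_infinity[OF sqrt_N_at_top], of 1] by simp
  have "(\<lambda>n. pi * z n * (1 / sqrt (N n))) \<longlonglongrightarrow> pi * y * 0"
    by (intro tendsto_intros z_tendsto inv)
  then have "u \<longlonglongrightarrow> 0" by (simp add: u_def)
  then have usmall: "eventually (\<lambda>n. \<bar>u n\<bar> < pi / 12) sequentially"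
    using tendstoD[of u 0 sequentially "pi / 12"] by simp
  define E where "E = (\<lambda>n. 2 * (log_sine_integral ((real (k n) + 1/2) * (pi / N n)) - log_sine_integral (5 * pi / 6)) / (pi / N n))"
  have "(\<lambda>n. 24 * pi\<^sup>2 * \<bar>z n\<bar> ^ 3 * (1 / sqrt (N n))) \<longlonglongrightarrow> 24 * pi\<^sup>2 * \<bar>y\<bar> ^ 3 * 0"
    by (intro tendsto_intros z_tendsto inv)
  then have bound0: "(\<lambda>n. 24 * pi\<^sup>2 * \<bar>z n\<bar> ^ 3 * (1 / sqrt (N n))) \<longlonglongrightarrow> 0" by simp
  have "eventually (\<lambda>n. norm (E n - (- (sqrt 3 * pi) * (z n)\<^sup>2)) \<le> 24 * pi\<^sup>2 * \<bar>z n\<bar> ^ 3 * (1 / sqrt (N n))) sequentially"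
    using eventually_large usmall
  proof eventually_elim
    case (elim n)
    define r where "r = sqrt (N n)"
    have r: "r > 0" "N n = r\<^sup>2" using elim(1) by (auto simp: r_def)
    have u: "u n = pi * z n / r" by (simp add: u_def r_def)
    have zr: "z n * r = real (k n) + 1/2 - 5 * r\<^sup>2 / 6" using r by (simp add: z_def r_def[symmetric])
    have "(real (k n) + 1/2) * (pi / N n) = (z n * r + 5 * r\<^sup>2 / 6) * (pi / r\<^sup>2)"
      by (simp add: zr r(2))
    also have "\<dots> = 5 * pi / 6 + u n"
      unfolding u using r(1) by (simp add: field_simps power2_eq_square)
    finally have arg: "(real (k n) + 1/2) * (pi / N n) = 5 * pi / 6 + u n" .
    define D where "D = log_sine_integral (5 * pi / 6 + u n) - log_sine_integral (5 * pi / 6) + sqrt 3 / 2 * (u n)\<^sup>2"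
    have D: "\<bar>D\<bar> \<le> 12 * \<bar>u n\<bar> ^ 3"
      unfolding D_def using elim(2) by (intro log_sine_integral_near_peak) auto
    have "E n = 2 * (D - sqrt 3 / 2 * (u n)\<^sup>2) / (pi / r\<^sup>2)"
      unfolding E_def arg by (simp add: D_def r(2))
    also have "\<dots> = 2 * r\<^sup>2 / pi * D - sqrt 3 * pi * (z n)\<^sup>2"
      unfolding u using r(1) by (simp add: field_simps power2_eq_square)
    finally have "\<bar>E n - (- (sqrt 3 * pi) * (z n)\<^sup>2)\<bar> = 2 * r\<^sup>2 / pi * \<bar>D\<bar>"
      using r(1) by (simp add: abs_mult)
    also have "\<dots> \<le> 2 * r\<^sup>2 / pi * (12 * \<bar>u n\<bar> ^ 3)"
      using D by (intro mult_left_mono) auto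
    also have "\<dots> = 24 * pi\<^sup>2 * \<bar>z n\<bar> ^ 3 * (1 / r)"
      unfolding u using r(1) by (simp add: abs_mult field_simps eval_nat_numeral)
    finally show ?case by (simp add: r_def)
  qed
  from Lim_null_comparison[OF this bound0]
  have "(\<lambda>n. E n - (- (sqrt 3 * pi) * (z n)\<^sup>2)) \<longlonglongrightarrow> 0" .
  moreover have "(\<lambda>n. - (sqrt 3 * pi) * (z n)\<^sup>2) \<longlonglongrightarrow> - (sqrt 3 * pi) * y\<^sup>2"
    by (intro tendsto_intros z_tendsto)
  ultimately have "(\<lambda>n. (E n - (- (sqrt 3 * pi) * (z n)\<^sup>2)) + (- (sqrt 3 * pi) * (z n)\<^sup>2)) \<longlonglongrightarrow> 0 + - (sqrt 3 * pi) * y\<^sup>2"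
    by (rule tendsto_add)
  then show ?thesis by (simp add: E_def)
qed

end

text \<open>
  On the range \<open>k < n\<close> of the Jones sum, this is the quotient of \<open>jones_term\<close> by \<open>N * exp (N * vol_fig8_complement / (2 * pi))\<close>, where
  \<open>N = n + a\<close>.
\<close>
definition normalized_term :: "real \<Rightarrow> nat \<Rightarrow> nat \<Rightarrow> real" where
  "normalized_term a n k = (let h = pi / (real n + a) in
     exp (2 * log_sine_sum_error h k) * shift_correction a h k *
     exp (2 * (log_sine_integral ((real k + 1/2) * h) - log_sine_integral (5 * pi / 6)) / h))"

lemma normalized_term_bound:
  assumes a: "a \<ge> 0"
  obtains C where "C \<ge> 0" "eventually (\<lambda>n. \<forall>k<n. \<bar>normalized_term a n k\<bar> \<le>
    C * exp (- (6 / 25) * ((real k + 1/2 - 5 * (real n + a) / 6) / sqrt (real n + a))\<^sup>2)) sequentially"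
proof -
  interpret near_peak a 0 by unfold_locales fact
  obtain C where C: "eventually (\<lambda>h. \<forall>k. (real k + 1) * h \<le> pi \<longrightarrow> \<bar>log_sine_sum_error h k\<bar> \<le> C) (at_right 0)"
    by (rule log_sine_sum_error_bounded)
  define B where "B = exp (2 * C) * exp (a\<^sup>2 * pi\<^sup>2 * (pi\<^sup>2 / 3))"
  show ?thesis
  proof (rule that[of B])
    show "B \<ge> 0" by (simp add: B_def)
    show "eventually (\<lambda>n. \<forall>k<n. \<bar>normalized_term a n k\<bar> \<le>
      B * exp (- (6 / 25) * ((real k + 1/2 - 5 * (real n + a) / 6) / sqrt (real n + a))\<^sup>2)) sequentially"
      using eventually_compose_filterlim[OF C h] eventually_large
    proof eventually_elim
      case (elim n)
      define h where "h = pi / N n"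
      have Np: "N n > 0" using elim by auto
      then have h: "h > 0" by (simp add: h_def)
      show ?case
      proof (intro allI impI)
        fix k assume "k < n"
        then have "real k + 1 \<le> N n" using a by (simp add: N_def)
        then have "(real k + 1) * h \<le> N n * h" using h by (intro mult_right_mono) auto
        then have k: "(real k + 1) * h \<le> pi" using Np by (simp add: h_def)
        have "exp (2 * log_sine_sum_error h k) * \<bar>shift_correction a h k\<bar> \<le> B"
          unfolding B_def
        proof (rule mult_mono)
          have "\<bar>log_sine_sum_error h k\<bar> \<le> C" using elim(1) k by (simp add: h_def)
          then show "exp (2 * log_sine_sum_error h k) \<le> exp (2 * C)" by simp
        qed (use shift_correction_bounded[OF h k] in auto)
        moreover have "2 * (log_sine_integral ((real k + 1/2) * h) - log_sine_integral (5 * pi / 6)) / h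
          \<le> - (6 / 25) * ((real k + 1/2 - 5 * N n / 6) / sqrt (N n))\<^sup>2"
        proof -
          have "(real k + 1/2) * h < (real k + 1) * h" using h by (intro mult_strict_right_mono) auto
          then have "(real k + 1/2) * h < pi" using k by linarith
          then have "log_sine_integral ((real k + 1/2) * h) - log_sine_integral (5 * pi / 6)
              \<le> - (3 / (25 * pi) * ((real k + 1/2) * h - 5 * pi / 6)\<^sup>2)"
            using log_sine_integral_peak_bound[of "(real k + 1/2) * h"] h by simp
          then have "2 * (log_sine_integral ((real k + 1/2) * h) - log_sine_integral (5 * pi / 6)) / h
              \<le> 2 * (- (3 / (25 * pi) * ((real k + 1/2) * h - 5 * pi / 6)\<^sup>2)) / h"
            using h by (intro divide_right_mono mult_left_mono) auto
          also have "(real k + 1/2) * h - 5 * pi / 6 = h * (real k + 1/2 - 5 * N n / 6)"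
            using Np by (simp add: h_def field_simps)
          also have "2 * (- (3 / (25 * pi) * (h * (real k + 1/2 - 5 * N n / 6))\<^sup>2)) / h
             = - (6 / 25) * ((real k + 1/2 - 5 * N n / 6) / sqrt (N n))\<^sup>2"
            using Np h by (simp add: power_mult_distrib power_divide h_def power2_eq_square)
          finally show ?thesis .
        qed
        ultimately have "(exp (2 * log_sine_sum_error h k) * \<bar>shift_correction a h k\<bar>) *
            exp (2 * (log_sine_integral ((real k + 1/2) * h) - log_sine_integral (5 * pi / 6)) / h)
           \<le> B * exp (- (6 / 25) * ((real k + 1/2 - 5 * N n / 6) / sqrt (N n))\<^sup>2)"
          by (intro mult_mono) (auto simp: B_def)
        then show "\<bar>normalized_term a n k\<bar> \<le>
            B * exp (- (6 / 25) * ((real k + 1/2 - 5 * (real n + a) / 6) / sqrt (real n + a))\<^sup>2)"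
          by (simp add: normalized_term_def Let_def h_def N_def abs_mult)
      qed
    qed
  qed
qed

text \<open>
  Laplace's method: in the rescaled variable \<open>y\<close> the terms converge to a Gaussian whose integral is
  \<open>sqrt (pi / (sqrt 3 * pi))\<close>.
\<close>
lemma sum_normalized_term_tendsto:
  assumes a: "a \<ge> 0"
  shows "(\<lambda>n. (\<Sum>k<n. normalized_term a n k) / sqrt (real n + a)) \<longlonglongrightarrow> sin_pi_quotient a / 3 powr (1/4)"
proof -
  obtain C where C: "C \<ge> 0" "eventually (\<lambda>n. \<forall>k<n. \<bar>normalized_term a n k\<bar> \<le>
    C * exp (- (6 / 25) * ((real k + 1/2 - 5 * (real n + a) / 6) / sqrt (real n + a))\<^sup>2)) sequentially"
    using normalized_term_bound[OF a] by blast
  let ?G = "\<lambda>y. sin_pi_quotient a * exp (- (sqrt 3 * pi) * y\<^sup>2)"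
  have "(\<lambda>n. (\<Sum>k<n. normalized_term a n k) / sqrt (real n + a)) \<longlonglongrightarrow> (\<integral>y. ?G y \<partial>lborel)"
  proof (rule lattice_sum_tendsto_integral[where c = "\<lambda>n. 5 * (real n + a) / 6", OF _ _ C(2) _ _ C(1)])
    interpret near_peak a 0 by unfold_locales fact
    show "eventually (\<lambda>n. 1 \<le> sqrt (real n + a)) sequentially"
      using eventually_large by eventually_elim (simp add: N_def)
  next
    fix y :: real
    interpret near_peak a y by unfold_locales fact
    show "eventually (\<lambda>n. 0 \<le> 5 * (real n + a) / 6 + sqrt (real n + a) * y
        \<and> nat \<lfloor>5 * (real n + a) / 6 + sqrt (real n + a) * y\<rfloor> < n) sequentially"
      using eventually_large
    proof eventually_elim
      case (elim n)
      show ?case using k_bounds[OF elim] by (simp add: N_def k_def)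
    qed
    have "(\<lambda>n. exp (2 * log_sine_sum_error (pi / N n) (k n)) * shift_correction a (pi / N n) (k n) *
        exp (2 * (log_sine_integral ((real (k n) + 1/2) * (pi / N n)) - log_sine_integral (5 * pi / 6)) / (pi / N n)))
        \<longlonglongrightarrow> exp (2 * 0) * sin_pi_quotient a * exp (- (sqrt 3 * pi) * y\<^sup>2)"
      by (intro tendsto_intros log_sine_sum_error_tendsto_0 shift_correction_tendsto peak_exponent_tendsto)
    then show "(\<lambda>n. normalized_term a n (nat \<lfloor>5 * (real n + a) / 6 + sqrt (real n + a) * y\<rfloor>)) \<longlonglongrightarrow> ?G y"
      by (simp add: normalized_term_def Let_def N_def k_def)
  qed auto
  also have "(\<integral>y. ?G y \<partial>lborel) = sin_pi_quotient a * sqrt (pi / (sqrt 3 * pi))"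
    using gaussian_integral[of "sqrt 3 * pi"] by simp
  also have "sqrt (pi / (sqrt 3 * pi)) = 1 / 3 powr (1/4)"
    by (simp add: powr_half_sqrt[symmetric] real_sqrt_divide powr_powr)
  finally show ?thesis by simp
qed

lemma sum_jones_term_tendsto:
  assumes a: "a \<ge> 0"
  shows "(\<lambda>n. (\<Sum>k<n. jones_term a (pi / (real n + a)) k) /
     ((real n + a) powr (3/2) * exp ((real n + a) * vol_fig8_complement / (2 * pi))))
     \<longlonglongrightarrow> sin_pi_quotient a / 3 powr (1/4)"
proof -
  have "eventually (\<lambda>n. (\<Sum>k<n. normalized_term a n k) / sqrt (real n + a) =
     (\<Sum>k<n. jones_term a (pi / (real n + a)) k) /
     ((real n + a) powr (3/2) * exp ((real n + a) * vol_fig8_complement / (2 * pi)))) sequentially"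
    using eventually_gt_at_top[of 0]
  proof eventually_elim
    case (elim n)
    define N where "N = real n + a"
    define h where "h = pi / N"
    have N: "N > 0" using elim a by (simp add: N_def)
    then have h: "h > 0" "pi / h = N" by (auto simp: h_def)
    have V: "2 * log_sine_integral (5 * pi / 6) / h = N * vol_fig8_complement / (2 * pi)"
      using N by (simp add: log_sine_integral_peak h_def)
    have "jones_term a h k = N * exp (N * vol_fig8_complement / (2 * pi)) * normalized_term a n k"
      if "k < n" for k
    proof -
      have "real k + 1 \<le> N" using that a by (simp add: N_def)
      then have "(real k + 1) * h \<le> N * h" using h by (intro mult_right_mono) auto
      then have k: "(real k + 1) * h \<le> pi" using N by (simp add: h_def)
      have "exp (2 * log_sine_integral ((real k + 1/2) * h) / h) =
        exp (N * vol_fig8_complement / (2 * pi)) *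
        exp (2 * (log_sine_integral ((real k + 1/2) * h) - log_sine_integral (5 * pi / 6)) / h)"
        unfolding V[symmetric] exp_add[symmetric] by (simp add: right_diff_distrib diff_divide_distrib)
      then show ?thesis
        unfolding jones_term_eq[OF h(1) k] h(2)
        by (simp add: normalized_term_def Let_def h_def N_def)
    qed
    then have "(\<Sum>k<n. jones_term a h k) = N * exp (N * vol_fig8_complement / (2 * pi)) * (\<Sum>k<n. normalized_term a n k)"
      by (simp add: sum_distrib_left)
    moreover have "N powr (3/2) = N * sqrt N"
      using N powr_add[of N 1 "1/2"] by (simp add: powr_half_sqrt)
    ultimately show ?case using N by (simp add: N_def[symmetric] h_def[symmetric])
  qed
  with sum_normalized_term_tendsto[OF a] show ?thesis by (rule Lim_transform_eventually)
qed

section \<open>The asymptotic formulas\<close>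

lemma sin_pi_quotient_nonzero:
  assumes "a \<ge> 0" "\<not> (\<exists>n::nat. n > 0 \<and> a = real n)"
  shows "sin_pi_quotient a \<noteq> 0"
proof
  assume "sin_pi_quotient a = 0"
  then have "a \<noteq> 0" "sin (a * pi) = 0" by (auto simp: sin_pi_quotient_def split: if_splits)
  then obtain i :: int where "a * pi = of_int i * pi" by (auto simp: sin_zero_iff_int2)
  then have "a = real (nat i)" "nat i > 0" using assms(1) \<open>a \<noteq> 0\<close> by auto
  with assms(2) show False by blast
qed

text \<open>
  The principal argument of \<open>- \<i>\<close> is \<open>- pi / 2\<close>.
\<close>
lemma powr_neg_imaginary:
  assumes "r > 0"
  shows "(complex_of_real r * (- \<i>)) powr complex_of_real x = complex_of_real (r powr x) * cis (- x * pi / 2)"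
proof -
  have L: "Ln (complex_of_real r * (- \<i>)) = of_real (ln r) + Ln (- \<i>)"
    using assms Ln_times_of_real[of r "- \<i>"] by (simp add: Ln_of_real)
  have "(complex_of_real r * (- \<i>)) powr complex_of_real x
      = exp (of_real x * Ln (complex_of_real r * (- \<i>)))"
    using assms by (simp add: powr_def)
  also have "\<dots> = exp (of_real (x * ln r)) * exp (\<i> * of_real (- x * pi / 2))"
    unfolding L by (simp add: exp_add[symmetric] algebra_simps)
  finally show ?thesis using assms by (simp add: cis_conv_exp powr_def exp_of_real[symmetric])
qed

text \<open>
  Both bases are positive multiples of \<open>- \<i>\<close>, so the phases of the two powers are \<open>- pi / 4\<close> and
  \<open>- 3 * pi / 4\<close>; together they give the factor \<open>-1\<close> that cancels the leading sign.
\<close>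
lemma prefactor_eq:
  assumes N: "N > 0"
  shows "- complex_of_real s * complex_of_real (2 * pi powr (3/2)) * (2 / csqrt (-3)) powr (1/2) *
      (complex_of_real N / (2 * complex_of_real pi * \<i>)) powr (3/2) *
      exp (complex_of_real N / (2 * complex_of_real pi * \<i>) * (\<i> * complex_of_real V))
    = complex_of_real (s * (1 / 3 powr (1/4)) * N powr (3/2) * exp (N * V / (2 * pi)))"
proof -
  have "csqrt (-3) = \<i> * complex_of_real (sqrt 3)"
    using csqrt_of_real_nonpos[of "-3"] by simp
  then have 1: "2 / csqrt (-3) = complex_of_real (2 / sqrt 3) * (- \<i>)"
    by (simp add: field_simps)
  have 2: "complex_of_real N / (2 * complex_of_real pi * \<i>) = complex_of_real (N / (2 * pi)) * (- \<i>)"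
    by (simp add: field_simps)
  have p1: "(2 / csqrt (-3)) powr (1/2) = complex_of_real ((2 / sqrt 3) powr (1/2)) * cis (- (1/2) * pi / 2)"
    unfolding 1 using powr_neg_imaginary[of "2 / sqrt 3" "1/2"] by simp
  have p2: "(complex_of_real N / (2 * complex_of_real pi * \<i>)) powr (3/2) =
      complex_of_real ((N / (2 * pi)) powr (3/2)) * cis (- (3/2) * pi / 2)"
    unfolding 2 using powr_neg_imaginary[of "N / (2 * pi)" "3/2"] N by simp
  have c: "cis (- (1/2) * pi / 2) * cis (- (3/2) * pi / 2) = - 1"
    by (simp add: cis_mult complex_eq_iff)
  have e: "exp (complex_of_real N / (2 * complex_of_real pi * \<i>) * (\<i> * complex_of_real V))
     = complex_of_real (exp (N * V / (2 * pi)))"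
    by (simp add: exp_of_real[symmetric])
  have r: "2 * pi powr (3/2) * (2 / sqrt 3) powr (1/2) * (N / (2 * pi)) powr (3/2) = 1 / 3 powr (1/4) * N powr (3/2)"
  proof -
    have "(2 / sqrt 3) powr (1/2) = 2 powr (1/2) / 3 powr (1/4)"
      by (simp add: powr_divide powr_half_sqrt[symmetric] powr_powr)
    moreover have "(N / (2 * pi)) powr (3/2) = N powr (3/2) / (2 powr (3/2) * pi powr (3/2))"
      using N by (simp add: powr_divide powr_mult)
    moreover have "2 powr (3/2) = 2 * 2 powr (1/2 :: real)"
      using powr_add[of 2 1 "1/2 :: real"] by simp
    ultimately show ?thesis by simp
  qed
  have collect: "- complex_of_real s * complex_of_real A * (complex_of_real B * c1) * (complex_of_real C * c2) * complex_of_real E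
      = - (c1 * c2) * complex_of_real (s * (A * B * C) * E)" for A B C E c1 c2
    by (simp add: mult_ac)
  show ?thesis unfolding p1 p2 e collect c r by (simp add: mult_ac)
qed

theorem theorem6:
  fixes a :: real
  assumes "a \<ge> 0"
    and "\<not> (\<exists>n::nat. n > 0 \<and> a = real n)"
  shows
    "(\<lambda>M::nat. colored_jones_fig8 M (2 * complex_of_real pi * \<i> / complex_of_real (real M + a)))
       \<sim>[sequentially]
     (\<lambda>M. - complex_of_real (sin_pi_quotient a) * complex_of_real (2 * pi powr (3/2)) *
           (2 / csqrt (-3)) powr (1/2) *
           (complex_of_real (real M + a) / (2 * complex_of_real pi * \<i>)) powr (3/2) *
           exp (complex_of_real (real M + a) / (2 * complex_of_real pi * \<i>) *
                (\<i> * complex_of_real vol_fig8_complement)))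
     \<and>
     (\<lambda>M::nat. colored_jones_fig8 M (2 * complex_of_real pi * \<i> / complex_of_real (real M + a)))
       \<sim>[sequentially]
     (\<lambda>M. complex_of_real
           (sin_pi_quotient a * (1 / 3 powr (1/4)) * (real M + a) powr (3/2) *
            exp ((real M + a) * vol_fig8_complement / (2 * pi))))"
    (is "?J \<sim>[_] ?f \<and> _ \<sim>[_] ?g")
proof -
  let ?S = "\<lambda>M. \<Sum>k<M. jones_term a (pi / (real M + a)) k"
  let ?r = "\<lambda>M::nat. (real M + a) powr (3/2) * exp ((real M + a) * vol_fig8_complement / (2 * pi))"
  let ?c = "sin_pi_quotient a / 3 powr (1/4)"
  have c: "?c \<noteq> 0" using sin_pi_quotient_nonzero[OF assms] by simp
  have "(\<lambda>M. complex_of_real (?S M / ?r M / ?c)) \<longlonglongrightarrow> complex_of_real (?c / ?c)"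
    by (intro tendsto_of_real tendsto_divide sum_jones_term_tendsto tendsto_const assms(1) c)
  then have "(\<lambda>M. complex_of_real (?S M / ?r M / ?c)) \<longlonglongrightarrow> 1" using c by simp
  moreover have "eventually (\<lambda>M. complex_of_real (?S M / ?r M / ?c) = ?J M / ?g M) sequentially"
    using eventually_gt_at_top[of 0]
  proof eventually_elim
    case (elim M)
    show ?case unfolding colored_jones_fig8_eq_sum[OF elim assms(1)]
      by (simp add: mult_ac)
  qed
  ultimately have "(\<lambda>M. ?J M / ?g M) \<longlonglongrightarrow> 1" by (rule Lim_transform_eventually)
  then have g: "?J \<sim>[sequentially] ?g" by (rule asymp_equivI')
  have "eventually (\<lambda>M. ?g M = ?f M) sequentially"
    using eventually_gt_at_top[of 0]
  proof eventually_elim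
    case (elim M)
    then have "real M + a > 0" using assms(1) by simp
    then show ?case by (simp only: prefactor_eq)
  qed
  then have "?g \<sim>[sequentially] ?f" by (rule asymp_equiv_refl_ev)
  with g show ?thesis using asymp_equiv_trans by blast
qed

end
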